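(* Let $T>0$ and $x\in E$. For every time step $h>0$ let $(\Phi_\theta)_{\theta\in\Theta}$ and $(\overline\Phi_\theta)_{\theta\in\Theta}=(\overline\Phi^{h}_\theta)_{\theta\in\Theta}$ satisfy the flow estimate: there exist positive constants $C_1,C_2$, independent of $h$ and $\theta$, such that for all $S\in(0,T]$, all $\theta\in\Theta$ and all $(\nu_1,\nu_2)\in\mathbb R^2$, $$\sup_{t\in[0,S]}|\Phi_\theta(t,\nu_1)-\overline\Phi_\theta(t,\nu_2)|\le e^{C_1S}|\nu_1-\nu_2|+C_2h .$$ Let $(x_t)_{t\in[0,T]}$ and $(\overline x_t)_{t\in[0,T]}$ be the PDPs with characteristics $(\Phi,\lambda,Q)$ and $(\overline\Phi,\lambda,Q)$ respectively, constructed by thinning from the same data $(N^*_t),(U_k),(V_k)$, with $x_0=\overline x_0=x$. Assume that $\Theta$ is finite and that, for all $\theta\in\Theta$ and all $A\subseteq\Theta$, the functions $\nu\mapsto\lambda(\theta,\nu)$ and $\nu\mapsto Q((\theta,\nu),A)$ are Lipschitz with constants $L_\lambda>0$ and $L_Q>0$ respectively, independent of $\theta$ (and of $A$). Then for every bounded function $F:E\to\mathbb R$ such that for all $\theta\in\Theta$ the function $\nu\mapsto F(\theta,\nu)$ is $L_F$-Lipschitz, with $L_F>0$ independent of $\theta$, there exist constants $V_1>0$ and $V_2>0$ independent of the time step $h$ such that $$\mathbb E\left[|F(\overline x_T)-F(x_T)|^2\right]\le V_1h+V_2h^2 .$$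
   Context: Let $\Theta=\{k_1,\dots,k_{|\Theta|}\}$ be a finite or countable set and $E=\Theta\times\mathbb R$; elements of $E$ are written $x=(\theta,\nu)$. A piecewise deterministic process (PDP) is specified by characteristics $(\Phi,\lambda,Q)$: (Borel measurable) functions $\Phi_\theta:\mathbb R_+\times\mathbb R\to\mathbb R$, $\theta\in\Theta$; a measurable function $\lambda:E\to(0,\infty)$; a transition kernel $Q$ on $E$ of the form $Q((\theta,\nu),A\times B)=Q((\theta,\nu),A)\,\delta_\nu(B)$ for $A\subseteq\Theta$, $B\in\mathcal B(\mathbb R)$ (only the $\theta$-component jumps). Standing assumption: there is a constant $\lambda^*<\infty$ with $\lambda(x)\le\lambda^*$ for all $x\in E$. Data: on a probability space, a homogeneous Poisson process $(N^*_t)_{t\ge0}$ with intensity $\lambda^*$ and jump times $(T^*_k)_{k\ge1}$, $T^*_0=0$; two i.i.d. sequences $(U_k)_{k\ge1}$, $(V_k)_{k\ge1}$ of uniform variables on $[0,1]$, independent of each other and of $(T^*_k)$. Construction by thinning: let $a_0=0$, $a_j(x)=\sum_{i=1}^jQ(x,\{k_i\})$ and $H(x,u)=\sum_i k_i\mathbf 1_{a_{i-1}(x)<u\le a_i(x)}$. Start from $(\theta_0,\nu_0)\in E$, $T_0=0$, $\tau_0=0$. For $n\ge1$, $$\tau_n=\inf\{k>\tau_{n-1}:U_k\lambda^*\le\lambda(\theta_{n-1},\Phi_{\theta_{n-1}}(T^*_k-T^*_{\tau_{n-1}},\nu_{n-1}))\},\qquad T_n=T^*_{\tau_n},$$ $$\nu_n=\Phi_{\theta_{n-1}}(T_n-T_{n-1},\nu_{n-1}),\qquad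 \theta_n=H((\theta_{n-1},\nu_n),V_n)$$ (with $T_n=\infty$ if the set is empty). The PDP is $x_t=(\theta_n,\Phi_{\theta_n}(t-T_n,\nu_n))$ for $t\in[T_n,T_{n+1})$, with $x_0=(\theta_0,\nu_0)$. *)

theory Defs
  imports "HOL-Probability.Probability" "HOL-Library.Extended_Nat"
begin

definition pdp_space :: "'k set \<Rightarrow> ('k \<times> real) measure" where
  "pdp_space \<Theta> = count_space \<Theta> \<Otimes>\<^sub>M borel"

text \<open>
  \<open>Q((\<theta>,\<nu>), A)\<close> for a set of modes \<open>A \<subseteq> \<Theta>\<close>, where \<open>Q\<close> is a kernel on \<open>E\<close>.
\<close>

definition mode_prob :: "('k \<times> real \<Rightarrow> ('k \<times> real) measure) \<Rightarrow> 'k \<times> real \<Rightarrow> 'k set \<Rightarrow> real" where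
  "mode_prob Q x A = measure (Q x) (A \<times> UNIV)"

definition flow_measurable :: "'k set \<Rightarrow> ('k \<Rightarrow> real \<Rightarrow> real \<Rightarrow> real) \<Rightarrow> bool" where
  "flow_measurable \<Theta> \<Phi> \<longleftrightarrow>
     (\<forall>\<theta>\<in>\<Theta>. (\<lambda>(t, \<nu>). \<Phi> \<theta> t \<nu>) \<in> borel_measurable (restrict_space borel ({0..} \<times> UNIV)))"

definition pdp_characteristics ::
  "'k set \<Rightarrow> ('k \<Rightarrow> real \<Rightarrow> real \<Rightarrow> real) \<Rightarrow> ('k \<times> real \<Rightarrow> real)
    \<Rightarrow> ('k \<times> real \<Rightarrow> ('k \<times> real) measure) \<Rightarrow> bool" where
  "pdp_characteristics \<Theta> \<Phi> lam Q \<longleftrightarrow>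
     flow_measurable \<Theta> \<Phi> \<and>
     lam \<in> borel_measurable (pdp_space \<Theta>) \<and> (\<forall>x\<in>\<Theta> \<times> UNIV. 0 < lam x) \<and>
     Q \<in> pdp_space \<Theta> \<rightarrow>\<^sub>M prob_algebra (pdp_space \<Theta>) \<and>
     (\<forall>\<theta>\<in>\<Theta>. \<forall>\<nu>. \<forall>A\<subseteq>\<Theta>. \<forall>B\<in>sets borel.
        measure (Q (\<theta>, \<nu>)) (A \<times> B) = mode_prob Q (\<theta>, \<nu>) A * indicator B \<nu>)"

definition flow_estimate ::
  "'k set \<Rightarrow> real \<Rightarrow> real \<Rightarrow> real \<Rightarrow> real
    \<Rightarrow> ('k \<Rightarrow> real \<Rightarrow> real \<Rightarrow> real) \<Rightarrow> ('k \<Rightarrow> real \<Rightarrow> real \<Rightarrow> real) \<Rightarrow> bool" where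
  "flow_estimate \<Theta> T C1 C2 h \<Phi> \<Psi> \<longleftrightarrow>
     (\<forall>S\<in>{0<..T}. \<forall>\<theta>\<in>\<Theta>. \<forall>\<nu>1 \<nu>2.
        (SUP t\<in>{0..S}. ereal \<bar>\<Phi> \<theta> t \<nu>1 - \<Psi> \<theta> t \<nu>2\<bar>) \<le> ereal (exp (C1 * S) * \<bar>\<nu>1 - \<nu>2\<bar> + C2 * h))"

definition (in prob_space) poisson_process :: "real \<Rightarrow> (real \<Rightarrow> 'a \<Rightarrow> nat) \<Rightarrow> bool" where
  "poisson_process rate N \<longleftrightarrow>
     (\<forall>t\<ge>0. random_variable (count_space UNIV) (N t)) \<and>
     (\<forall>\<omega>\<in>space M. N 0 \<omega> = 0 \<and> mono_on {0..} (\<lambda>t. N t \<omega>) \<and>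
        (\<forall>t\<ge>0. continuous (at_right t) (\<lambda>s. N s \<omega>))) \<and>
     (\<forall>s\<ge>0. \<forall>t>s. distr M (count_space UNIV) (\<lambda>\<omega>. N t \<omega> - N s \<omega>)
                     = measure_pmf (poisson_pmf (rate * (t - s)))) \<and>
     (\<forall>t :: nat \<Rightarrow> real. 0 \<le> t 0 \<and> mono t \<longrightarrow>
        indep_vars (\<lambda>_. count_space UNIV) (\<lambda>i \<omega>. N (t (Suc i)) \<omega> - N (t i) \<omega>) UNIV)"

text \<open>
  The jump times \<open>T\<^sup>*\<^sub>k\<close>, with \<open>T\<^sup>*\<^sub>0 = 0\<close>.  They are finite only almost surely, hence the
  type \<^typ>\<open>ereal\<close>.
\<close>

definition jump_time :: "(real \<Rightarrow> 'w \<Rightarrow> nat) \<Rightarrow> nat \<Rightarrow> 'w \<Rightarrow> ereal" where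
  "jump_time N k \<omega> = (INF t\<in>{t. 0 \<le> t \<and> k \<le> N t \<omega>}. ereal t)"

definition (in prob_space) generated_events :: "(nat \<Rightarrow> 'a \<Rightarrow> 'b::topological_space) \<Rightarrow> 'a set set" where
  "generated_events X = sigma_sets (space M) {X j -` B \<inter> space M | j B. 1 \<le> j \<and> B \<in> sets borel}"

locale thinning_data = prob_space M for M :: "'w measure" +
  fixes lamstar :: real
    and N :: "real \<Rightarrow> 'w \<Rightarrow> nat"
    and U V :: "nat \<Rightarrow> 'w \<Rightarrow> real"
  assumes poisson: "poisson_process lamstar N"
    and indep_U: "indep_vars (\<lambda>_. borel) U {1..}"
    and indep_V: "indep_vars (\<lambda>_. borel) V {1..}"
    and uniform_U: "\<And>k. k \<ge> 1 \<Longrightarrow> distr M lborel (U k) = uniform_measure lborel {0..1}"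
    and uniform_V: "\<And>k. k \<ge> 1 \<Longrightarrow> distr M lborel (V k) = uniform_measure lborel {0..1}"
    and indep_UVT: "indep_sets
          (\<lambda>i. [generated_events U, generated_events V, generated_events (jump_time N)] ! i) {..<3}"

text \<open>
  From here on \<open>\<Theta>\<close> is finite and \<open>k\<close> enumerates it, \<open>\<Theta> = {k 1, \<dots>, k (card \<Theta>)}\<close>.
\<close>

definition cum_prob ::
  "(nat \<Rightarrow> 'k) \<Rightarrow> ('k \<times> real \<Rightarrow> ('k \<times> real) measure) \<Rightarrow> nat \<Rightarrow> 'k \<times> real \<Rightarrow> real" where
  "cum_prob k Q j x = (\<Sum>i=1..j. mode_prob Q x {k i})"

text \<open>
  \<open>H(x, u) = \<Sum>\<^sub>i k\<^sub>i 1(a\<^sub>i\<^sub>-\<^sub>1(x) < u \<le> a\<^sub>i(x))\<close>.  The sum has exactly one nonzero term if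
  \<open>0 < u \<le> 1\<close>; outside this range, which the uniform variables avoid almost surely, the value
  \<open>k 1\<close> keeps the process in \<open>\<Theta>\<close>.
\<close>

definition select_mode ::
  "'k set \<Rightarrow> (nat \<Rightarrow> 'k) \<Rightarrow> ('k \<times> real \<Rightarrow> ('k \<times> real) measure) \<Rightarrow> 'k \<times> real \<Rightarrow> real \<Rightarrow> 'k" where
  "select_mode \<Theta> k Q x u =
     (if \<exists>i\<in>{1..card \<Theta>}. cum_prob k Q (i - 1) x < u \<and> u \<le> cum_prob k Q i x
      then k (THE i. i \<in> {1..card \<Theta>} \<and> cum_prob k Q (i - 1) x < u \<and> u \<le> cum_prob k Q i x)
      else k 1)"

text \<open>
  Thinning is defined pathwise: \<open>ts\<close>, \<open>u\<close>, \<open>v\<close> are realisations of \<open>(T\<^sup>*\<^sub>k)\<close>, \<open>(U\<^sub>k)\<close>, \<open>(V\<^sub>k)\<close>.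
  The infimum of the empty set is \<open>\<infinity>\<close>.
\<close>

definition next_index ::
  "real \<Rightarrow> ('k \<Rightarrow> real \<Rightarrow> real \<Rightarrow> real) \<Rightarrow> ('k \<times> real \<Rightarrow> real)
    \<Rightarrow> (nat \<Rightarrow> ereal) \<Rightarrow> (nat \<Rightarrow> real) \<Rightarrow> enat \<Rightarrow> 'k \<Rightarrow> real \<Rightarrow> enat" where
  "next_index lamstar \<Phi> lam ts u \<tau> \<theta> \<nu> =
     Inf {enat j | j. \<tau> < enat j \<and>
            u j * lamstar \<le> lam (\<theta>, \<Phi> \<theta> (real_of_ereal (ts j - ts (the_enat \<tau>))) \<nu>)}"

definition index_time :: "(nat \<Rightarrow> ereal) \<Rightarrow> enat \<Rightarrow> ereal" where
  "index_time ts \<tau> = (case \<tau> of enat j \<Rightarrow> ts j | \<infinity> \<Rightarrow> \<infinity>)"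

text \<open>
  The triples \<open>(\<tau>\<^sub>n, \<theta>\<^sub>n, \<nu>\<^sub>n)\<close>.  The components \<open>\<theta>\<^sub>n\<close>, \<open>\<nu>\<^sub>n\<close> are meaningful only if \<open>T\<^sub>n < \<infinity>\<close>.
\<close>

primrec thinning ::
  "'k set \<Rightarrow> (nat \<Rightarrow> 'k) \<Rightarrow> real
    \<Rightarrow> ('k \<Rightarrow> real \<Rightarrow> real \<Rightarrow> real) \<Rightarrow> ('k \<times> real \<Rightarrow> real) \<Rightarrow> ('k \<times> real \<Rightarrow> ('k \<times> real) measure)
    \<Rightarrow> 'k \<times> real \<Rightarrow> (nat \<Rightarrow> ereal) \<Rightarrow> (nat \<Rightarrow> real) \<Rightarrow> (nat \<Rightarrow> real) \<Rightarrow> nat \<Rightarrow> enat \<times> 'k \<times> real" where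
  "thinning \<Theta> k lamstar \<Phi> lam Q x0 ts u v 0 = (0, fst x0, snd x0)"
| "thinning \<Theta> k lamstar \<Phi> lam Q x0 ts u v (Suc n) =
     (let (\<tau>, \<theta>, \<nu>) = thinning \<Theta> k lamstar \<Phi> lam Q x0 ts u v n;
          \<tau>' = next_index lamstar \<Phi> lam ts u \<tau> \<theta> \<nu>;
          \<nu>' = \<Phi> \<theta> (real_of_ereal (index_time ts \<tau>' - index_time ts \<tau>)) \<nu>
      in (\<tau>', select_mode \<Theta> k Q (\<theta>, \<nu>') (v (Suc n)), \<nu>'))"

definition pdp_path ::
  "'k set \<Rightarrow> (nat \<Rightarrow> 'k) \<Rightarrow> real
    \<Rightarrow> ('k \<Rightarrow> real \<Rightarrow> real \<Rightarrow> real) \<Rightarrow> ('k \<times> real \<Rightarrow> real) \<Rightarrow> ('k \<times> real \<Rightarrow> ('k \<times> real) measure)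
    \<Rightarrow> 'k \<times> real \<Rightarrow> (nat \<Rightarrow> ereal) \<Rightarrow> (nat \<Rightarrow> real) \<Rightarrow> (nat \<Rightarrow> real) \<Rightarrow> real \<Rightarrow> 'k \<times> real" where
  "pdp_path \<Theta> k lamstar \<Phi> lam Q x0 ts u v t =
     (let z = thinning \<Theta> k lamstar \<Phi> lam Q x0 ts u v;
          Tn = (\<lambda>n. index_time ts (fst (z n)));
          n = (THE n. Tn n \<le> ereal t \<and> ereal t < Tn (Suc n));
          (\<theta>, \<nu>) = snd (z n)
      in (\<theta>, \<Phi> \<theta> (real_of_ereal (ereal t - Tn n)) \<nu>))"

definition pdp ::
  "'k set \<Rightarrow> (nat \<Rightarrow> 'k) \<Rightarrow> real
    \<Rightarrow> ('k \<Rightarrow> real \<Rightarrow> real \<Rightarrow> real) \<Rightarrow> ('k \<times> real \<Rightarrow> real) \<Rightarrow> ('k \<times> real \<Rightarrow> ('k \<times> real) measure)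
    \<Rightarrow> 'k \<times> real \<Rightarrow> (real \<Rightarrow> 'w \<Rightarrow> nat) \<Rightarrow> (nat \<Rightarrow> 'w \<Rightarrow> real) \<Rightarrow> (nat \<Rightarrow> 'w \<Rightarrow> real)
    \<Rightarrow> real \<Rightarrow> 'w \<Rightarrow> 'k \<times> real" where
  "pdp \<Theta> k lamstar \<Phi> lam Q x0 N U V t \<omega> =
     pdp_path \<Theta> k lamstar \<Phi> lam Q x0
       (\<lambda>j. jump_time N j \<omega>) (\<lambda>j. U j \<omega>) (\<lambda>j. V j \<omega>) t"

end

theory Submission
  imports Defs
begin

text \<open>
  The two processes are compared jump by jump.  As long as they have accepted the same Poisson
  points and chosen the same modes, the flow estimate gives, after \<open>n\<close> jumps,
  \<open>\<bar>\<nu>\<^sub>n - \<nu>\<^sub>n'\<bar> \<le> C\<^sub>2 h (K + 1)\<^sup>n\<close> with \<open>K = exp (C\<^sub>1 T)\<close>, a deterministic bound.  They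
  separate at the Poisson point \<open>j\<close> only if \<open>U\<^sub>j\<close> or \<open>V\<^sub>n\<^sub>+\<^sub>1\<close> falls between two thresholds that
  differ by a constant times this bound and are independent of that variable; by Fubini this has
  probability \<open>O(h (K + 1)\<^sup>j) P(N\<^sub>T \<ge> j)\<close>.  The exponential moments of \<open>N\<^sub>T\<close> make the sum over
  \<open>n < j\<close> of order \<open>h\<close>.  Off this event the error is at most \<open>L\<^sub>F C\<^sub>2 h R\<close> with
  \<open>R = (K + 1)^(N\<^sub>T + 1)\<close>, whose square has expectation of order \<open>h\<^sup>2\<close>.
\<close>

text \<open>The obstacle is that the acceptance threshold for \<open>U j\<close> is computed from a
  state which formally depends on the whole sequence \<open>U\<close>, so independence cannot be
  applied to it directly. However, a state whose index is still below \<open>j\<close> is determined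
  without \<open>U j\<close>, and state \<open>n\<close> is determined without
  \<open>V (Suc n)\<close>. Freezing the variable in question at 0 therefore changes nothing on the
  relevant event, and it makes the thresholds measurable with respect to all the remaining data.

  Mismatch sets are not shown to be measurable themselves; each is enclosed in an event of small
  probability.

  On the mismatch event nothing is known about the distance of the two processes, so only the bound
  on \<open>F\<close> is available there. This is why the mean square error has a term linear in
  \<open>h\<close>, while the flow error alone would give \<open>h\<^sup>2\<close>.\<close>

section \<open>Randomised thresholds\<close>

text \<open>Given \<open>G\<close>, the variable \<open>X\<close> is still uniform while
  \<open>a\<close> and \<open>b\<close> are constants. The two tests disagree only if
  \<open>X\<close> falls in the half-open interval between them, whose length on \<open>A\<close> is
  at most \<delta>.\<close>

lemma (in prob_space) prob_threshold_mismatch: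
  assumes X[measurable]: "X \<in> borel_measurable M"
    and G: "space G = space M" "sets G \<subseteq> events"
    and indep: "\<And>A B. A \<in> sets borel \<Longrightarrow> B \<in> sets G
      \<Longrightarrow> prob (X -` A \<inter> space M \<inter> B) = prob (X -` A \<inter> space M) * prob B"
    and unif: "distr M lborel X = uniform_measure lborel {0..1}"
    and a[measurable]: "a \<in> borel_measurable G" and b[measurable]: "b \<in> borel_measurable G"
    and A: "A \<in> sets G" and \<delta>: "\<And>\<omega>. \<omega> \<in> A \<Longrightarrow> \<bar>a \<omega> - b \<omega>\<bar> \<le> (\<delta>::real)" and "\<delta> \<ge> 0"
  shows "{\<omega>\<in>space M. \<omega> \<in> A \<and> (X \<omega> \<le> a \<omega>) \<noteq> (X \<omega> \<le> b \<omega>)} \<in> events"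
    and "prob {\<omega>\<in>space M. \<omega> \<in> A \<and> (X \<omega> \<le> a \<omega>) \<noteq> (X \<omega> \<le> b \<omega>)} \<le> \<delta> * prob A"
proof -
  have id[measurable]: "(\<lambda>\<omega>. \<omega>) \<in> measurable M G"
    by (rule measurableI) (use G in \<open>auto simp: Int_absorb2 dest: sets.sets_into_space\<close>)
  define W where "W = {p\<in>space (borel \<Otimes>\<^sub>M G). snd p \<in> A \<and> (fst p \<le> a (snd p)) \<noteq> (fst p \<le> b (snd p))}"
  have W: "W \<in> sets (borel \<Otimes>\<^sub>M G)"
    unfolding W_def using A by measurable
  have pre: "(\<lambda>\<omega>. (X \<omega>, \<omega>)) -` W \<inter> space M = {\<omega>\<in>space M. \<omega> \<in> A \<and> (X \<omega> \<le> a \<omega>) \<noteq> (X \<omega> \<le> b \<omega>)}"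
    using sets.sets_into_space[OF A] by (auto simp: W_def space_pair_measure)
  have "(\<lambda>\<omega>. (X \<omega>, \<omega>)) -` W \<inter> space M \<in> events"
    by (rule measurable_sets[OF _ W]) measurable
  then show ev: "{\<omega>\<in>space M. \<omega> \<in> A \<and> (X \<omega> \<le> a \<omega>) \<noteq> (X \<omega> \<le> b \<omega>)} \<in> events"
    by (simp only: pre)
  have GM: "B \<in> events" "B \<inter> space M = B" if "B \<in> sets G" for B
    using that G sets.sets_into_space[of B G] by auto
  interpret PX: prob_space "distr M borel X" by (rule prob_space_distr) simp
  interpret PG: prob_space "distr M G (\<lambda>\<omega>. \<omega>)" by (rule prob_space_distr) simp
  interpret PP: pair_sigma_finite "distr M borel X" "distr M G (\<lambda>\<omega>. \<omega>)" ..
  \<comment> \<open>Independence as a product law for the pair of \<open>X\<close> and the identity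
    map into \<open>G\<close>. Fubini can then integrate over \<open>X\<close> first, with
    \<open>a\<close>, \<open>b\<close> and membership in \<open>A\<close> fixed by the second
    coordinate.\<close>
  have prod: "distr M borel X \<Otimes>\<^sub>M distr M G (\<lambda>\<omega>. \<omega>) = distr M (borel \<Otimes>\<^sub>M G) (\<lambda>\<omega>. (X \<omega>, \<omega>))"
  proof (rule pair_measure_eqI)
    fix B C assume "B \<in> sets (distr M borel X)" "C \<in> sets (distr M G (\<lambda>\<omega>. \<omega>))"
    then have B: "B \<in> sets borel" and C: "C \<in> sets G" by auto
    have "(\<lambda>\<omega>. (X \<omega>, \<omega>)) -` (B \<times> C) \<inter> space M = X -` B \<inter> space M \<inter> C" by auto
    then show "emeasure (distr M borel X) B * emeasure (distr M G (\<lambda>\<omega>. \<omega>)) C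
        = emeasure (distr M (borel \<Otimes>\<^sub>M G) (\<lambda>\<omega>. (X \<omega>, \<omega>))) (B \<times> C)"
      using B C by (simp add: emeasure_distr emeasure_eq_measure GM indep flip: ennreal_mult)
  qed (auto intro: PX.sigma_finite_measure PG.sigma_finite_measure cong: sets_pair_measure_cong)
  have sec: "emeasure (distr M borel X) ((\<lambda>x. (x, \<omega>)) -` W) \<le> ennreal \<delta> * indicator A \<omega>" for \<omega>
  proof (cases "\<omega> \<in> A")
    case False
    then have "(\<lambda>x. (x, \<omega>)) -` W = {}" by (auto simp: W_def)
    then show ?thesis by simp
  next
    case True
    let ?I = "{min (a \<omega>) (b \<omega>)<..max (a \<omega>) (b \<omega>)}"
    have "(\<lambda>x. (x, \<omega>)) -` W \<subseteq> ?I" by (auto simp: W_def)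
    then have "emeasure (distr M borel X) ((\<lambda>x. (x, \<omega>)) -` W) \<le> emeasure (distr M borel X) ?I"
      by (intro emeasure_mono) auto
    also have "\<dots> = emeasure (distr M lborel X) ?I"
      by (simp add: emeasure_distr)
    also have "\<dots> = emeasure lborel ({0..1} \<inter> ?I)"
      unfolding unif by (subst emeasure_uniform_measure) (auto simp: divide_ennreal_def)
    also have "\<dots> \<le> emeasure lborel ?I"
      by (intro emeasure_mono) auto
    also have "\<dots> = ennreal \<bar>a \<omega> - b \<omega>\<bar>"
      by (auto simp: min_def max_def abs_if)
    also have "\<dots> \<le> ennreal \<delta> * indicator A \<omega>"
      using True \<delta>[OF True] by (simp add: ennreal_leI)
    finally show ?thesis .
  qed
  have "emeasure M {\<omega>\<in>space M. \<omega> \<in> A \<and> (X \<omega> \<le> a \<omega>) \<noteq> (X \<omega> \<le> b \<omega>)}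
      = emeasure (distr M (borel \<Otimes>\<^sub>M G) (\<lambda>\<omega>. (X \<omega>, \<omega>))) W"
    using W by (subst emeasure_distr) (simp_all only: pre, measurable)
  also have "\<dots> = (\<integral>\<^sup>+\<omega>. emeasure (distr M borel X) ((\<lambda>x. (x, \<omega>)) -` W) \<partial>distr M G (\<lambda>\<omega>. \<omega>))"
    unfolding prod[symmetric] by (rule PP.emeasure_pair_measure_alt2) (use W in simp)
  also have "\<dots> \<le> (\<integral>\<^sup>+\<omega>. ennreal \<delta> * indicator A \<omega> \<partial>distr M G (\<lambda>\<omega>. \<omega>))"
    by (intro nn_integral_mono sec)
  also have "\<dots> = ennreal \<delta> * emeasure M A"
    using A GM(2)[OF A] by (subst nn_integral_cmult_indicator) (auto simp: emeasure_distr)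
  also have "\<dots> = ennreal (\<delta> * prob A)"
    using \<open>\<delta> \<ge> 0\<close> by (simp add: emeasure_eq_measure ennreal_mult)
  finally show "prob {\<omega>\<in>space M. \<omega> \<in> A \<and> (X \<omega> \<le> a \<omega>) \<noteq> (X \<omega> \<le> b \<omega>)} \<le> \<delta> * prob A"
    using \<open>\<delta> \<ge> 0\<close> by (simp add: emeasure_eq_measure)
qed

section \<open>Independence of one variable from all the other data\<close>

lemma (in prob_space) generated_eventsI:
  "1 \<le> j \<Longrightarrow> B \<in> sets borel \<Longrightarrow> X j -` B \<inter> space M \<in> generated_events X"
  unfolding generated_events_def by (rule sigma_sets.Basic) blast

lemma (in prob_space) sigma_algebra_generated_events: "sigma_algebra (space M) (generated_events X)"
  unfolding generated_events_def by (rule sigma_algebra_sigma_sets) auto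

text \<open>Merges two layers of independence, inside the sequence \<open>X\<close> and between the
  three families, into one sigma-algebra that sees everything except \<open>X j\<close>.
  Intersections of an event of the other \<open>X i\<close>, one of \<open>Y\<close> and one of
  \<open>Z\<close> form a pi-system independent of \<open>X j\<close>, and this extends to the
  generated sigma-algebra. \<open>U\<close> and \<open>V\<close> each take the role of
  \<open>X\<close> later.\<close>

lemma (in prob_space) ex_complementary_sigma_algebra:
  fixes X :: "nat \<Rightarrow> 'a \<Rightarrow> 'b::topological_space"
    and Y :: "nat \<Rightarrow> 'a \<Rightarrow> 'c::topological_space" and Z :: "nat \<Rightarrow> 'a \<Rightarrow> 'd::topological_space"
  assumes X: "indep_vars (\<lambda>_. borel) X {1..}"
    and events: "generated_events Y \<subseteq> events" "generated_events Z \<subseteq> events"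
    and indep: "\<And>A B C. A \<in> generated_events X \<Longrightarrow> B \<in> generated_events Y \<Longrightarrow> C \<in> generated_events Z
      \<Longrightarrow> prob (A \<inter> B \<inter> C) = prob A * prob B * prob C"
    and j: "1 \<le> j"
  shows "\<exists>G. space G = space M \<and> sets G \<subseteq> events \<and>
    (\<forall>i\<ge>1. i \<noteq> j \<longrightarrow> X i \<in> borel_measurable G) \<and>
    (\<forall>i\<ge>1. Y i \<in> borel_measurable G) \<and> (\<forall>i\<ge>1. Z i \<in> borel_measurable G) \<and>
    (\<forall>A\<in>sets borel. \<forall>B\<in>sets G. prob (X j -` A \<inter> space M \<inter> B) = prob (X j -` A \<inter> space M) * prob B)"
proof -
  define E where "E i = {X i -` B \<inter> space M | B. B \<in> sets borel}" for i
  have Xm: "X i \<in> borel_measurable M" if "1 \<le> i" for i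
    using X that unfolding indep_vars_def2 by auto
  have EP: "E i \<subseteq> Pow (space M)" for i by (auto simp: E_def)
  have stE: "Int_stable (E i)" for i
  proof (rule Int_stableI)
    fix a b assume "a \<in> E i" "b \<in> E i"
    then obtain B C where "B \<in> sets borel" "C \<in> sets borel"
      and ab: "a = X i -` B \<inter> space M" "b = X i -` C \<inter> space M"
      by (auto simp: E_def)
    then have "B \<inter> C \<in> sets borel" by auto
    moreover have "a \<inter> b = X i -` (B \<inter> C) \<inter> space M" using ab by auto
    ultimately show "a \<inter> b \<in> E i" unfolding E_def by blast
  qed
  define I where "I c = (if c then {j} else {1..} - {j})" for c
  define S where "S c = sigma_sets (space M) (\<Union>i\<in>I c. E i)" for c
  have "indep_sets E {1..}"
    using X unfolding indep_vars_def2 E_def by auto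
  moreover have "{1..} = (\<Union>c\<in>UNIV. I c)" using j by (auto simp: I_def UNIV_bool)
  ultimately have "indep_sets S UNIV"
    unfolding S_def
    by (intro indep_sets_collect_sigma) (auto simp: stE disjoint_family_on_def I_def)
  then have SX: "prob (A \<inter> B) = prob A * prob B" if "A \<in> S True" "B \<in> S False" for A B
    using that indep_setsD[of S UNIV UNIV "\<lambda>c. if c then A else B"] by (auto simp: UNIV_bool Int_commute mult.commute)
  have S_gen: "S c \<subseteq> generated_events X" for c
    unfolding S_def generated_events_def
    by (rule sigma_sets_mono') (use j in \<open>auto simp: I_def E_def split: if_splits; blast\<close>)
  interpret gX: sigma_algebra "space M" "generated_events X" by (rule sigma_algebra_generated_events)
  interpret gY: sigma_algebra "space M" "generated_events Y" by (rule sigma_algebra_generated_events)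
  interpret gZ: sigma_algebra "space M" "generated_events Z" by (rule sigma_algebra_generated_events)
  have sS: "sigma_algebra (space M) (S c)" for c
    unfolding S_def by (rule sigma_algebra_sigma_sets) (use EP in auto)
  interpret sT: sigma_algebra "space M" "S True" by (rule sS)
  interpret sF: sigma_algebra "space M" "S False" by (rule sS)
  have gXe: "generated_events X \<subseteq> events"
    unfolding generated_events_def
    by (rule sets.sigma_sets_subset) (use Xm in \<open>auto intro: measurable_sets\<close>)
  define R where "R = {A \<inter> B \<inter> C | A B C. A \<in> S False \<and> B \<in> generated_events Y \<and> C \<in> generated_events Z}"
  have RI: "A \<in> S False \<Longrightarrow> B \<in> generated_events Y \<Longrightarrow> C \<in> generated_events Z \<Longrightarrow> A \<inter> B \<inter> C \<in> R" for A B C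
    unfolding R_def by blast
  have Re: "R \<subseteq> events"
  proof
    fix r assume "r \<in> R"
    then obtain A B C where "r = A \<inter> B \<inter> C" "A \<in> S False" "B \<in> generated_events Y" "C \<in> generated_events Z"
      unfolding R_def by blast
    then show "r \<in> events" using S_gen gXe events by (auto intro!: sets.Int)
  qed
  then have RP: "R \<subseteq> Pow (space M)" using sets.space_closed by blast
  have stR: "Int_stable R"
  proof (rule Int_stableI)
    fix a b assume "a \<in> R" "b \<in> R"
    then obtain A B C A' B' C' where
      *: "A \<in> S False" "B \<in> generated_events Y" "C \<in> generated_events Z"
         "A' \<in> S False" "B' \<in> generated_events Y" "C' \<in> generated_events Z"
      and ab: "a = A \<inter> B \<inter> C" "b = A' \<inter> B' \<inter> C'"
      unfolding R_def by blast
    have "(A \<inter> A') \<inter> (B \<inter> B') \<inter> (C \<inter> C') \<in> R"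
      using * by (intro RI) auto
    moreover have "a \<inter> b = (A \<inter> A') \<inter> (B \<inter> B') \<inter> (C \<inter> C')" using ab by auto
    ultimately show "a \<inter> b \<in> R" by simp
  qed
  have "indep_set (E j) R"
  proof (rule indep_setI)
    show "E j \<subseteq> events" using Xm[OF j] by (auto simp: E_def)
    show "R \<subseteq> events" by (rule Re)
    fix a r assume a: "a \<in> E j" and "r \<in> R"
    then obtain A B C where r: "r = A \<inter> B \<inter> C" and *: "A \<in> S False" "B \<in> generated_events Y" "C \<in> generated_events Z"
      unfolding R_def by blast
    have aS: "a \<in> S True" unfolding S_def using a by (auto simp: I_def)
    \<comment> \<open>Independence of the families is used twice: forwards with the
      \<open>X\<close>-event \<open>a \<inter> A\<close>, then backwards with \<open>A\<close>
      alone. In between, independence inside \<open>X\<close> splits off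
      \<open>prob a\<close>.\<close>
    have "prob (a \<inter> r) = prob ((a \<inter> A) \<inter> B \<inter> C)" unfolding r by (simp add: Int_assoc)
    also have "\<dots> = prob (a \<inter> A) * prob B * prob C"
      using * aS S_gen by (intro indep gX.Int) auto
    also have "\<dots> = prob a * (prob A * prob B * prob C)" using SX[OF aS *(1)] by simp
    also have "prob A * prob B * prob C = prob r" unfolding r using * S_gen by (intro indep[symmetric]) auto
    finally show "prob (a \<inter> r) = prob a * prob r" .
  qed
  then have ind: "indep_set (sigma_sets (space M) (E j)) (sigma_sets (space M) R)"
    by (rule indep_set_sigma_sets) (rule stE stR)+
  define G where "G = sigma (space M) R"
  have sG: "sets G = sigma_sets (space M) R" "space G = space M"
    unfolding G_def using RP by (auto simp: space_measure_of_conv)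
  have GM: "sets G \<subseteq> events" unfolding sG by (rule sets.sigma_sets_subset[OF Re])
  \<comment> \<open>Filling two of the three slots with the whole space shows that each single
    preimage lies in \<open>R\<close>.\<close>
  have top: "space M \<in> S False" "space M \<in> generated_events Y" "space M \<in> generated_events Z" by auto
  have mG: "f \<in> borel_measurable G" if "\<And>B. B \<in> sets borel \<Longrightarrow> f -` B \<inter> space M \<in> R" for f :: "'a \<Rightarrow> 'e::topological_space"
    by (rule measurableI) (use that in \<open>auto simp: sG\<close>)
  show ?thesis
  proof (intro exI[of _ G] conjI allI impI ballI)
    show "space G = space M" "sets G \<subseteq> events" by (fact sG GM)+
    show "X i \<in> borel_measurable G" if "1 \<le> i" "i \<noteq> j" for i
    proof (rule mG)
      fix B :: "'b set" assume "B \<in> sets borel"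
      then have "X i -` B \<inter> space M \<in> S False"
        unfolding S_def using that by (intro sigma_sets.Basic) (auto simp: I_def E_def)
      from RI[OF this top(2,3)] show "X i -` B \<inter> space M \<in> R" by (simp add: Int_assoc)
    qed
    show "Y i \<in> borel_measurable G" if "1 \<le> i" for i
    proof (rule mG)
      fix B :: "'c set" assume "B \<in> sets borel"
      from RI[OF top(1) generated_eventsI[OF that this, of Y] top(3)]
      show "Y i -` B \<inter> space M \<in> R" by (simp add: Int_assoc Int_commute Int_left_commute)
    qed
    show "Z i \<in> borel_measurable G" if "1 \<le> i" for i
    proof (rule mG)
      fix B :: "'d set" assume "B \<in> sets borel"
      from RI[OF top(1,2) generated_eventsI[OF that this, of Z]]
      show "Z i -` B \<inter> space M \<in> R" by (simp add: Int_assoc Int_commute Int_left_commute)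
    qed
    fix A B assume "A \<in> sets (borel :: 'b measure)" "B \<in> sets G"
    then show "prob (X j -` A \<inter> space M \<inter> B) = prob (X j -` A \<inter> space M) * prob B"
      by (intro indep_setD[OF ind]) (auto simp: sG E_def)
  qed
qed

section \<open>Measurability of the thinning recursion\<close>

lemma Inf_enat_in: "A \<noteq> {} \<Longrightarrow> Inf A \<in> A" for A :: "enat set"
  using LeastI[of "\<lambda>y. y \<in> A"] by (auto simp: Inf_enat_def)

lemma Inf_enat_eq_enat_iff: "Inf {enat j | j. P j} = enat m \<longleftrightarrow> P m \<and> (\<forall>i<m. \<not> P i)"
proof
  assume *: "Inf {enat j | j. P j} = enat m"
  have "{enat j | j. P j} \<noteq> {}" using * by (force simp: Inf_enat_def)
  then have "Inf {enat j | j. P j} \<in> {enat j | j. P j}"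
    by (rule Inf_enat_in)
  then have "P m" using * by auto
  moreover have "\<not> P i" if "i < m" for i
    using Inf_lower[of "enat i" "{enat j | j. P j}"] that * by auto
  ultimately show "P m \<and> (\<forall>i<m. \<not> P i)" by blast
next
  assume *: "P m \<and> (\<forall>i<m. \<not> P i)"
  show "Inf {enat j | j. P j} = enat m"
  proof (rule antisym)
    show "Inf {enat j | j. P j} \<le> enat m" using * by (intro Inf_lower) auto
    show "enat m \<le> Inf {enat j | j. P j}"
      using * by (intro Inf_greatest) (auto simp: not_less[symmetric])
  qed
qed

text \<open>A finite value \<open>enat m\<close> is decided by the candidates up to \<open>m\<close>
  alone. Both the insensitivity to later \<open>u\<close> and the comparison of the two processes
  rest on this form.\<close>

lemma next_index_eq_enat_iff:
  "next_index lamstar \<Phi> lam ts u \<tau> \<theta> \<nu> = enat m \<longleftrightarrow>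
     (\<tau> < enat m \<and> u m * lamstar \<le> lam (\<theta>, \<Phi> \<theta> (real_of_ereal (ts m - ts (the_enat \<tau>))) \<nu>)) \<and>
     (\<forall>i<m. \<not> (\<tau> < enat i \<and> u i * lamstar \<le> lam (\<theta>, \<Phi> \<theta> (real_of_ereal (ts i - ts (the_enat \<tau>))) \<nu>)))"
  unfolding next_index_def by (rule Inf_enat_eq_enat_iff)

lemma less_next_index: "\<tau> = \<infinity> \<or> \<tau> < next_index lamstar \<Phi> lam ts u \<tau> \<theta> \<nu>"
proof (cases "next_index lamstar \<Phi> lam ts u \<tau> \<theta> \<nu>")
  case (enat m)
  then have "\<tau> < enat m" by (simp only: next_index_eq_enat_iff)
  with enat show ?thesis by simp
next
  case infinity
  then show ?thesis by (cases \<tau>) auto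
qed

lemma next_index_ge: "\<tau> \<le> next_index lamstar \<Phi> lam ts u \<tau> \<theta> \<nu>"
proof -
  have "next_index lamstar \<Phi> lam ts u \<infinity> \<theta> \<nu> = \<infinity>"
    by (cases "next_index lamstar \<Phi> lam ts u \<infinity> \<theta> \<nu>") (auto simp: next_index_eq_enat_iff)
  then show ?thesis using less_next_index[of \<tau> lamstar \<Phi> lam ts u \<theta> \<nu>] by (auto simp: less_imp_le)
qed

lemma index_time_mono: "mono ts \<Longrightarrow> \<tau> \<le> \<sigma> \<Longrightarrow> index_time ts \<tau> \<le> index_time ts \<sigma>"
  by (cases \<tau>; cases \<sigma>) (auto simp: index_time_def mono_def)

lemma measurable_index_time:
  assumes ts[measurable]: "\<And>j. ts j \<in> borel_measurable G" and \<tau>: "\<tau> \<in> measurable G (count_space UNIV)"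
  shows "(\<lambda>\<omega>. index_time (\<lambda>j. ts j \<omega>) (\<tau> \<omega>)) \<in> borel_measurable G"
proof (rule measurable_compose_countable[OF _ \<tau>])
  show "(\<lambda>\<omega>. index_time (\<lambda>j. ts j \<omega>) i) \<in> borel_measurable G" for i
    by (cases i) (auto simp: index_time_def)
qed

text \<open>The index takes countably many values, so constant indices suffice. At \<infinity> the
  term \<open>the_enat\<close> is an unspecified constant, which does no harm to
  measurability.\<close>

lemma measurable_elapsed:
  fixes ts :: "nat \<Rightarrow> 'w \<Rightarrow> ereal"
  assumes ts[measurable]: "\<And>j. ts j \<in> borel_measurable G" and \<tau>: "\<tau> \<in> measurable G (count_space UNIV)"
  shows "(\<lambda>\<omega>. real_of_ereal (ts j \<omega> - ts (the_enat (\<tau> \<omega>)) \<omega>)) \<in> borel_measurable G"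
proof -
  have [measurable]: "(\<lambda>\<omega>. ts (the_enat (\<tau> \<omega>)) \<omega>) \<in> borel_measurable G"
    by (rule measurable_compose_countable[OF _ \<tau>]) simp
  show ?thesis by measurable
qed

text \<open>Neither a flow nor a probability space is fixed, so that each fact serves both
  processes. Measurability is asked for one mode at a time, which suffices for finitely many
  modes.\<close>

locale thinning_modes =
  fixes \<Theta> :: "'k set" and k :: "nat \<Rightarrow> 'k" and lamstar :: real
    and lam :: "'k \<times> real \<Rightarrow> real" and Q :: "'k \<times> real \<Rightarrow> ('k \<times> real) measure" and x0 :: "'k \<times> real"
  assumes finite_modes: "finite \<Theta>" and enum_modes: "bij_betw k {1..card \<Theta>} \<Theta>"
    and x0: "x0 \<in> \<Theta> \<times> UNIV" and lamstar_pos: "0 < lamstar"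
    and lam_measurable: "\<And>\<theta>. \<theta> \<in> \<Theta> \<Longrightarrow> (\<lambda>\<nu>. lam (\<theta>, \<nu>)) \<in> borel_measurable borel"
    and mode_prob_measurable:
      "\<And>\<theta> A. \<theta> \<in> \<Theta> \<Longrightarrow> A \<subseteq> \<Theta> \<Longrightarrow> (\<lambda>\<nu>. mode_prob Q (\<theta>, \<nu>) A) \<in> borel_measurable borel"
begin

abbreviation thin where "thin \<Phi> ts u v n \<equiv> thinning \<Theta> k lamstar \<Phi> lam Q x0 ts u v n"

abbreviation thin_index where "thin_index \<Phi> ts u v n \<equiv> fst (thin \<Phi> ts u v n)"

abbreviation thin_mode where "thin_mode \<Phi> ts u v n \<equiv> fst (snd (thin \<Phi> ts u v n))"

abbreviation thin_value where "thin_value \<Phi> ts u v n \<equiv> snd (snd (thin \<Phi> ts u v n))"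

lemma enum_in: "i \<in> {1..card \<Theta>} \<Longrightarrow> k i \<in> \<Theta>"
  using enum_modes by (auto simp: bij_betw_def)

lemma enum_1_in: "k 1 \<in> \<Theta>"
  using x0 finite_modes by (intro enum_in) (auto simp: Suc_le_eq card_gt_0_iff)

lemma cum_prob_mono: "i \<le> j \<Longrightarrow> cum_prob k Q i y \<le> cum_prob k Q j y"
  unfolding cum_prob_def by (rule sum_mono2) (auto simp: mode_prob_def)

lemma cum_prob_unique:
  assumes "1 \<le> i" "1 \<le> j" "cum_prob k Q (i - 1) y < w" "w \<le> cum_prob k Q i y"
    "cum_prob k Q (j - 1) y < w" "w \<le> cum_prob k Q j y"
  shows "i = j"
proof (rule ccontr)
  assume "i \<noteq> j"
  then have "i \<le> j - 1 \<or> j \<le> i - 1" by linarith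
  then show False
    using cum_prob_mono[of i "j - 1" y] cum_prob_mono[of j "i - 1" y] assms(3-6) by linarith
qed

text \<open>Holds for every real \<open>w\<close> thanks to the default \<open>k 1\<close>, so no
  null set has to be removed to keep the paths in \<Theta>.\<close>

lemma select_mode_in: "select_mode \<Theta> k Q y w \<in> \<Theta>"
proof (cases "\<exists>i\<in>{1..card \<Theta>}. cum_prob k Q (i - 1) y < w \<and> w \<le> cum_prob k Q i y")
  case True
  then obtain i where i: "i \<in> {1..card \<Theta>} \<and> cum_prob k Q (i - 1) y < w \<and> w \<le> cum_prob k Q i y" by blast
  then have "(THE i. i \<in> {1..card \<Theta>} \<and> cum_prob k Q (i - 1) y < w \<and> w \<le> cum_prob k Q i y) = i"
    by (intro the_equality) (auto intro: cum_prob_unique)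
  then show ?thesis using i True enum_in[of i] by (simp add: select_mode_def)
next
  case False
  then show ?thesis unfolding select_mode_def using enum_1_in by (simp only: if_False)
qed

text \<open>The selected mode depends on \<open>w\<close> only through the tests
  \<open>w \<le> cum_prob k Q i y\<close>, the strict lower tests being their negations at
  \<open>i - 1\<close>. A wrong mode thus reduces to one threshold mismatch.\<close>

lemma select_mode_neqD:
  assumes "select_mode \<Theta> k Q y w \<noteq> select_mode \<Theta> k Q z w"
  shows "\<exists>i\<in>{1..card \<Theta>}. (w \<le> cum_prob k Q i y) \<noteq> (w \<le> cum_prob k Q i z)"
proof (rule ccontr)
  assume *: "\<not> ?thesis"
  \<comment> \<open>Index 0 enters as \<open>i - 1\<close>; both sums are empty there, so the tests
    agree.\<close>
  have "(w \<le> cum_prob k Q i y) = (w \<le> cum_prob k Q i z)" if "i \<le> card \<Theta>" for i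
    using * that by (cases "i = 0") (auto simp: cum_prob_def)
  then have "i \<in> {1..card \<Theta>} \<and> cum_prob k Q (i - 1) y < w \<and> w \<le> cum_prob k Q i y \<longleftrightarrow>
    i \<in> {1..card \<Theta>} \<and> cum_prob k Q (i - 1) z < w \<and> w \<le> cum_prob k Q i z" for i
    by (auto simp: not_le[symmetric])
  then have "select_mode \<Theta> k Q y w = select_mode \<Theta> k Q z w"
    unfolding select_mode_def Bex_def by (simp only:)
  with assms show False by simp
qed

lemma thin_mode_in: "thin_mode \<Phi> ts u v n \<in> \<Theta>"
  using x0 select_mode_in by (cases n) (auto simp: Let_def split: prod.splits)

lemma thin_index_Suc:
  "thin_index \<Phi> ts u v (Suc n) = next_index lamstar \<Phi> lam ts u
     (thin_index \<Phi> ts u v n) (thin_mode \<Phi> ts u v n) (thin_value \<Phi> ts u v n)"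
  by (simp add: Let_def split: prod.splits)

lemma thin_value_Suc:
  "thin_value \<Phi> ts u v (Suc n) = \<Phi> (thin_mode \<Phi> ts u v n)
     (real_of_ereal (index_time ts (thin_index \<Phi> ts u v (Suc n)) - index_time ts (thin_index \<Phi> ts u v n)))
     (thin_value \<Phi> ts u v n)"
  by (simp add: Let_def split: prod.splits)

lemma thin_mode_Suc:
  "thin_mode \<Phi> ts u v (Suc n) =
     select_mode \<Theta> k Q (thin_mode \<Phi> ts u v n, thin_value \<Phi> ts u v (Suc n)) (v (Suc n))"
  by (simp add: Let_def split: prod.splits)

declare thinning.simps(2)[simp del]

lemma thin_index_mono: "thin_index \<Phi> ts u v n \<le> thin_index \<Phi> ts u v (Suc n)"
  unfolding thin_index_Suc by (rule next_index_ge)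

text \<open>Every jump uses up at least one Poisson point. This bounds the number of jumps by the
  number of points and excludes explosion.\<close>

lemma thin_index_ge: "enat n \<le> thin_index \<Phi> ts u v n"
proof (induction n)
  case 0
  show ?case by (simp add: zero_enat_def)
next
  case (Suc n)
  show ?case
    using less_next_index[of "thin_index \<Phi> ts u v n" lamstar \<Phi> lam ts u "thin_mode \<Phi> ts u v n" "thin_value \<Phi> ts u v n"]
      thin_index_mono[of \<Phi> ts u v n] Suc
    unfolding thin_index_Suc[symmetric]
    by (cases "thin_index \<Phi> ts u v n"; cases "thin_index \<Phi> ts u v (Suc n)") auto
qed

text \<open>
  On the event that \<open>j\<close> is not yet reached, the state is insensitive to \<open>u j\<close>; replacing \<open>u j\<close> by
  a constant therefore yields a version of the state that is independent of \<open>U\<^sub>j\<close>.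
\<close>

lemma thin_upd_u:
  assumes "thin_index \<Phi> ts u v n < enat j"
  shows "thin \<Phi> ts (u(j := c)) v n = thin \<Phi> ts u v n"
  using assms
proof (induction n)
  case (Suc n)
  then obtain m where m: "thin_index \<Phi> ts u v (Suc n) = enat m" "m < j"
    by (cases "thin_index \<Phi> ts u v (Suc n)") auto
  have IH: "thin \<Phi> ts (u(j := c)) v n = thin \<Phi> ts u v n"
    using Suc.IH le_less_trans[OF thin_index_mono Suc.prems] by blast
  \<comment> \<open>The characterisation of the value \<open>enat m\<close> reads \<open>u\<close>
    only at indices up to \<open>m < j\<close>, where the update is invisible.\<close>
  have "thin_index \<Phi> ts (u(j := c)) v (Suc n) = enat m"
    using m unfolding thin_index_Suc IH next_index_eq_enat_iff by auto
  then have i: "thin_index \<Phi> ts (u(j := c)) v (Suc n) = thin_index \<Phi> ts u v (Suc n)"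
    by (simp only: m(1))
  have w: "thin_value \<Phi> ts (u(j := c)) v (Suc n) = thin_value \<Phi> ts u v (Suc n)"
    by (simp add: thin_value_Suc IH i)
  have "thin_mode \<Phi> ts (u(j := c)) v (Suc n) = thin_mode \<Phi> ts u v (Suc n)"
    by (simp add: thin_mode_Suc IH w)
  with i w show ?case by (intro prod_eqI)
qed simp

text \<open>Step \<open>n\<close> draws its mode with \<open>v n\<close>: the position in
  \<open>v\<close> is deterministic, in contrast to the random position in \<open>u\<close>.\<close>

lemma thin_upd_v:
  assumes "n < i"
  shows "thin \<Phi> ts u (v(i := c)) n = thin \<Phi> ts u v n"
  using assms by (induction n) (auto simp: thinning.simps)

lemma index_time_thin_mono:
  assumes "mono ts" "m \<le> n"
  shows "index_time ts (thin_index \<Phi> ts u v m) \<le> index_time ts (thin_index \<Phi> ts u v n)"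
  by (rule index_time_mono[OF assms(1)])
    (rule lift_Suc_mono_le[of "thin_index \<Phi> ts u v", OF thin_index_mono assms(2)])

lemma thin_step_unique:
  assumes "mono ts"
    and "index_time ts (thin_index \<Phi> ts u v m) \<le> t" "t < index_time ts (thin_index \<Phi> ts u v (Suc m))"
    and "index_time ts (thin_index \<Phi> ts u v n) \<le> t" "t < index_time ts (thin_index \<Phi> ts u v (Suc n))"
  shows "m = n"
proof (rule ccontr)
  assume "m \<noteq> n"
  then have "Suc m \<le> n \<or> Suc n \<le> m" by linarith
  then show False
    using index_time_thin_mono[OF assms(1), of "Suc m" n \<Phi> u v]
      index_time_thin_mono[OF assms(1), of "Suc n" m \<Phi> u v] assms(2-5)
    by (auto dest: order.trans[of _ _ t] simp: not_less[symmetric])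
qed

text \<open>Since the index after \<open>n\<close> jumps is at least \<open>n\<close>, the jump
  times pass \<open>t\<close> after finitely many steps, and the step before the first passage is
  the current one. This gives the \<open>THE\<close> in \<open>pdp_path\<close> its meaning.\<close>

lemma ex1_thin_step:
  assumes mono: "mono ts" and "ts 0 \<le> t" and m: "\<exists>m. t < ts m"
  shows "\<exists>!n. index_time ts (thin_index \<Phi> ts u v n) \<le> t \<and> t < index_time ts (thin_index \<Phi> ts u v (Suc n))"
proof -
  let ?t = "\<lambda>n. index_time ts (thin_index \<Phi> ts u v n)"
  from m obtain m where "t < ts m" by blast
  also have "ts m \<le> ?t m"
    using index_time_mono[OF mono thin_index_ge[of m \<Phi> ts u v]] by (simp add: index_time_def)
  finally have ex: "t < ?t m" .
  define n where "n = (LEAST n. t < ?t n)"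
  have n: "t < ?t n" unfolding n_def using ex by (rule LeastI)
  have "?t 0 = ts 0" by (simp add: index_time_def zero_enat_def)
  then have "n \<noteq> 0" using n \<open>ts 0 \<le> t\<close> by (metis not_le)
  then obtain l where l: "n = Suc l" by (cases n) auto
  have "\<not> t < ?t l" using l not_less_Least[of l "\<lambda>n. t < ?t n"] by (simp add: n_def)
  then have "?t l \<le> t \<and> t < ?t (Suc l)" using n l by (simp add: not_less)
  then show ?thesis using thin_step_unique[OF mono] by blast
qed

lemma pdp_path_eq:
  assumes "mono ts"
    and n: "index_time ts (thin_index \<Phi> ts u v n) \<le> ereal t"
      "ereal t < index_time ts (thin_index \<Phi> ts u v (Suc n))"
  shows "pdp_path \<Theta> k lamstar \<Phi> lam Q x0 ts u v t = (thin_mode \<Phi> ts u v n,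
    \<Phi> (thin_mode \<Phi> ts u v n) (real_of_ereal (ereal t - index_time ts (thin_index \<Phi> ts u v n))) (thin_value \<Phi> ts u v n))"
proof -
  have "(THE n. index_time ts (thin_index \<Phi> ts u v n) \<le> ereal t
      \<and> ereal t < index_time ts (thin_index \<Phi> ts u v (Suc n))) = n"
    using n thin_step_unique[OF assms(1)] by (intro the_equality) blast+
  then show ?thesis
    unfolding pdp_path_def Let_def by (simp add: case_prod_beta)
qed

lemma pdp_path_in: "pdp_path \<Theta> k lamstar \<Phi> lam Q x0 ts u v t \<in> \<Theta> \<times> UNIV"
  unfolding pdp_path_def Let_def by (simp add: case_prod_beta thin_mode_in)

lemma measurable_on_modes:
  assumes \<theta>: "\<theta> \<in> measurable G (count_space \<Theta>)" and g: "g \<in> borel_measurable G"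
    and f: "\<And>\<theta>. \<theta> \<in> \<Theta> \<Longrightarrow> (\<lambda>\<nu>. f (\<theta>, \<nu>)) \<in> borel_measurable borel"
  shows "(\<lambda>\<omega>. f (\<theta> \<omega>, g \<omega>)) \<in> borel_measurable G"
  by (rule measurable_compose_countable'[OF _ \<theta>])
    (auto intro: countable_finite finite_modes measurable_compose[OF g f])

lemma cum_prob_measurable:
  assumes "\<theta> \<in> \<Theta>" "i \<le> card \<Theta>"
  shows "(\<lambda>\<nu>. cum_prob k Q i (\<theta>, \<nu>)) \<in> borel_measurable borel"
  unfolding cum_prob_def using assms enum_in
  by (intro borel_measurable_sum mode_prob_measurable) auto

lemma measurable_select_mode:
  assumes \<theta>: "\<theta> \<in> measurable G (count_space \<Theta>)" and g: "g \<in> borel_measurable G"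
    and w[measurable]: "w \<in> borel_measurable G"
  shows "(\<lambda>\<omega>. select_mode \<Theta> k Q (\<theta> \<omega>, g \<omega>) (w \<omega>)) \<in> measurable G (count_space \<Theta>)"
proof -
  define P where "P i \<omega> \<longleftrightarrow> i \<in> {1..card \<Theta>} \<and> cum_prob k Q (i - 1) (\<theta> \<omega>, g \<omega>) < w \<omega> \<and> w \<omega> \<le> cum_prob k Q i (\<theta> \<omega>, g \<omega>)" for i \<omega>
  have [measurable]: "Measurable.pred G (P i)" for i
  proof (cases "i \<in> {1..card \<Theta>}")
    case True
    then have [measurable]: "(\<lambda>\<omega>. cum_prob k Q (i - 1) (\<theta> \<omega>, g \<omega>)) \<in> borel_measurable G"
      "(\<lambda>\<omega>. cum_prob k Q i (\<theta> \<omega>, g \<omega>)) \<in> borel_measurable G"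
      by (auto intro!: measurable_on_modes[OF \<theta> g, where f = "cum_prob k Q _"] cum_prob_measurable)
    show ?thesis unfolding P_def by measurable
  next
    case False
    then have "P i = (\<lambda>\<omega>. False)" unfolding P_def by auto
    then show ?thesis by simp
  qed
  have [measurable]: "(\<lambda>\<omega>. THE i. P i \<omega>) \<in> measurable G (count_space UNIV)"
  proof (rule measurable_THE[where I = UNIV])
    show "i = j" if "P i \<omega>" "P j \<omega>" for \<omega> i j
      using that unfolding P_def by (intro cum_prob_unique[of i j _ "w \<omega>"]) auto
  qed auto
  have eq: "select_mode \<Theta> k Q (\<theta> \<omega>, g \<omega>) (w \<omega>) = k (if \<exists>i. P i \<omega> then THE i. P i \<omega> else 1)" for \<omega>
    unfolding select_mode_def P_def Bex_def by (simp only: if_distrib[of k])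
  have "(\<lambda>\<omega>. select_mode \<Theta> k Q (\<theta> \<omega>, g \<omega>) (w \<omega>)) \<in> measurable G (count_space UNIV)"
    unfolding eq by measurable
  then show ?thesis
    unfolding measurable_count_space_eq2[OF finite_modes] using select_mode_in
    by (auto intro: measurable_sets)
qed

text \<open>\<open>flow_measurable\<close> says nothing about negative times. \<open>max 0\<close>
  lands in the half-plane where it applies, and users remove it where the elapsed time is
  nonnegative.\<close>

lemma measurable_flow:
  assumes \<Phi>: "flow_measurable \<Theta> \<Phi>" and \<theta>: "\<theta> \<in> measurable G (count_space \<Theta>)"
    and [measurable]: "f \<in> borel_measurable G" "g \<in> borel_measurable G"
  shows "(\<lambda>\<omega>. \<Phi> (\<theta> \<omega>) (max 0 (f \<omega>)) (g \<omega>)) \<in> borel_measurable G"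
proof (rule measurable_compose_countable'[OF _ \<theta>])
  show "countable \<Theta>" using finite_modes by (rule countable_finite)
  fix \<theta>' assume "\<theta>' \<in> \<Theta>"
  then have m: "(\<lambda>(t, \<nu>). \<Phi> \<theta>' t \<nu>) \<in> borel_measurable (restrict_space borel ({0..} \<times> UNIV))"
    using \<Phi> by (simp add: flow_measurable_def)
  have "(\<lambda>\<omega>. (max 0 (f \<omega>), g \<omega>)) \<in> measurable G (borel \<Otimes>\<^sub>M borel)"
    by measurable
  then have "(\<lambda>\<omega>. (max 0 (f \<omega>), g \<omega>)) \<in> borel_measurable G"
    by (simp only: borel_prod)
  then have "(\<lambda>\<omega>. (max 0 (f \<omega>), g \<omega>)) \<in> measurable G (restrict_space borel ({0..} \<times> UNIV))"
    by (intro measurable_restrict_space2) auto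
  from measurable_compose[OF this m]
  show "(\<lambda>\<omega>. \<Phi> \<theta>' (max 0 (f \<omega>)) (g \<omega>)) \<in> borel_measurable G" by simp
qed

context
  fixes G :: "'w measure" and \<Phi> :: "'k \<Rightarrow> real \<Rightarrow> real \<Rightarrow> real"
    and ts :: "nat \<Rightarrow> 'w \<Rightarrow> ereal" and u v :: "nat \<Rightarrow> 'w \<Rightarrow> real"
  assumes \<Phi>: "flow_measurable \<Theta> \<Phi>"
    and ts[measurable]: "\<And>j. ts j \<in> borel_measurable G"
    and u[measurable]: "\<And>j. 1 \<le> j \<Longrightarrow> u j \<in> borel_measurable G"
    and v: "\<And>j. 1 \<le> j \<Longrightarrow> v j \<in> borel_measurable G"
    and ts_mono: "\<And>\<omega>. \<omega> \<in> space G \<Longrightarrow> mono (\<lambda>j. ts j \<omega>)"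
begin

text \<open>\<open>G\<close> is arbitrary because the recursion has to be measurable both for the
  full sigma-algebra and for one that omits a single variable.\<close>

lemma measurable_next_index:
  assumes \<tau>[measurable]: "\<tau> \<in> measurable G (count_space UNIV)"
    and \<theta>: "\<theta> \<in> measurable G (count_space \<Theta>)" and \<nu>: "\<nu> \<in> borel_measurable G"
  shows "(\<lambda>\<omega>. next_index lamstar \<Phi> lam (\<lambda>j. ts j \<omega>) (\<lambda>j. u j \<omega>) (\<tau> \<omega>) (\<theta> \<omega>) (\<nu> \<omega>))
    \<in> measurable G (count_space UNIV)" (is "?n \<in> _")
proof -
  define P where "P j \<omega> \<longleftrightarrow> \<tau> \<omega> < enat j \<and> u j \<omega> * lamstar
    \<le> lam (\<theta> \<omega>, \<Phi> (\<theta> \<omega>) (real_of_ereal (ts j \<omega> - ts (the_enat (\<tau> \<omega>)) \<omega>)) (\<nu> \<omega>))" for j \<omega>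
  have P: "{\<omega>\<in>space G. P j \<omega>} \<in> sets G" for j
  \<comment> \<open>Nothing is known about \<open>u 0\<close>, but index 0 is never a candidate,
    since no index lies below it.\<close>
  proof (cases "j = 0")
    case True
    then show ?thesis by (simp add: P_def zero_enat_def[symmetric])
  next
    case False
    then have [measurable]: "u j \<in> borel_measurable G" by (intro u) auto
    have [measurable]: "(\<lambda>\<omega>. lam (\<theta> \<omega>, \<Phi> (\<theta> \<omega>) (max 0 (real_of_ereal (ts j \<omega> - ts (the_enat (\<tau> \<omega>)) \<omega>))) (\<nu> \<omega>)))
      \<in> borel_measurable G"
      by (rule measurable_on_modes[where f = lam, OF \<theta> _ lam_measurable])
        (intro measurable_flow[OF \<Phi> \<theta> _ \<nu>] measurable_elapsed[of ts, OF ts \<tau>])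
    have "max 0 (real_of_ereal (ts j \<omega> - ts (the_enat (\<tau> \<omega>)) \<omega>)) = real_of_ereal (ts j \<omega> - ts (the_enat (\<tau> \<omega>)) \<omega>)"
      if "\<omega> \<in> space G" "\<tau> \<omega> < enat j" for \<omega>
      using that ts_mono[OF that(1)]
      by (cases "\<tau> \<omega>") (auto simp: max_def mono_def ereal_diff_positive real_of_ereal_pos)
    then have "{\<omega>\<in>space G. P j \<omega>} = {\<omega>\<in>space G. \<tau> \<omega> < enat j \<and> u j \<omega> * lamstar
      \<le> lam (\<theta> \<omega>, \<Phi> (\<theta> \<omega>) (max 0 (real_of_ereal (ts j \<omega> - ts (the_enat (\<tau> \<omega>)) \<omega>))) (\<nu> \<omega>))}"
      unfolding P_def by (intro Collect_cong) auto
    also have "\<dots> \<in> sets G" by measurable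
    finally show ?thesis .
  qed
  have [measurable]: "Measurable.pred G (P j)" for j using P[of j] by (simp add: pred_def)
  have fin: "?n -` {enat m} \<inter> space G \<in> sets G" for m
  proof -
    have "?n -` {enat m} \<inter> space G = {\<omega>\<in>space G. P m \<omega> \<and> (\<forall>i<m. \<not> P i \<omega>)}"
      by (auto simp: next_index_eq_enat_iff P_def)
    also have "\<dots> \<in> sets G" by measurable
    finally show ?thesis .
  qed
  moreover have "?n -` {\<infinity>} \<inter> space G \<in> sets G"
  proof -
    have "?n -` {\<infinity>} \<inter> space G = space G - (\<Union>m. ?n -` {enat m} \<inter> space G)"
      by (auto simp: not_infinity_eq)
    also have "\<dots> \<in> sets G" by (intro sets.Diff sets.countable_UN'' fin) auto
    finally show ?thesis .
  qed
  ultimately have "?n -` {a} \<inter> space G \<in> sets G" for a by (cases a) auto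
  then show ?thesis
    by (subst measurable_count_space_eq2_countable) auto
qed

lemma measurable_thin:
  "(\<lambda>\<omega>. thin_index \<Phi> (\<lambda>j. ts j \<omega>) (\<lambda>j. u j \<omega>) (\<lambda>j. v j \<omega>) n) \<in> measurable G (count_space UNIV)"
  "(\<lambda>\<omega>. thin_mode \<Phi> (\<lambda>j. ts j \<omega>) (\<lambda>j. u j \<omega>) (\<lambda>j. v j \<omega>) n) \<in> measurable G (count_space \<Theta>)"
  "(\<lambda>\<omega>. thin_value \<Phi> (\<lambda>j. ts j \<omega>) (\<lambda>j. u j \<omega>) (\<lambda>j. v j \<omega>) n) \<in> borel_measurable G"
proof (induction n)
  case 0
  {
    case 1 show ?case by simp
  next
    case 2 show ?case using x0 by auto
  next
    case 3 show ?case by simp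
  }
next
  case (Suc n)
  let ?\<tau> = "\<lambda>n \<omega>. thin_index \<Phi> (\<lambda>j. ts j \<omega>) (\<lambda>j. u j \<omega>) (\<lambda>j. v j \<omega>) n"
  let ?\<theta> = "\<lambda>n \<omega>. thin_mode \<Phi> (\<lambda>j. ts j \<omega>) (\<lambda>j. u j \<omega>) (\<lambda>j. v j \<omega>) n"
  let ?\<nu> = "\<lambda>n \<omega>. thin_value \<Phi> (\<lambda>j. ts j \<omega>) (\<lambda>j. u j \<omega>) (\<lambda>j. v j \<omega>) n"
  let ?t = "\<lambda>n \<omega>. index_time (\<lambda>j. ts j \<omega>) (?\<tau> n \<omega>)"
  have 1: "?\<tau> (Suc n) \<in> measurable G (count_space UNIV)"
    unfolding thin_index_Suc by (intro measurable_next_index Suc.IH)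
  have [measurable]: "?t n \<in> borel_measurable G" "?t (Suc n) \<in> borel_measurable G"
    by (intro measurable_index_time[of ts, OF ts] 1 Suc.IH)+
  \<comment> \<open>The truncation is removed in the next step: the times do not decrease along the
    recursion, and \<open>real_of_ereal\<close> sends an infinite difference to 0.\<close>
  have "(\<lambda>\<omega>. \<Phi> (?\<theta> n \<omega>) (max 0 (real_of_ereal (?t (Suc n) \<omega> - ?t n \<omega>))) (?\<nu> n \<omega>)) \<in> borel_measurable G"
    by (intro measurable_flow[OF \<Phi>] Suc.IH) measurable
  also have "?this \<longleftrightarrow> ?\<nu> (Suc n) \<in> borel_measurable G"
    unfolding thin_value_Suc
    by (intro measurable_cong arg_cong3[where f = \<Phi>] refl)
      (auto simp: max_def intro: real_of_ereal_pos ereal_diff_positive index_time_mono[OF ts_mono thin_index_mono])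
  finally have 3: "?\<nu> (Suc n) \<in> borel_measurable G" .
  have 2: "?\<theta> (Suc n) \<in> measurable G (count_space \<Theta>)"
    unfolding thin_mode_Suc by (intro measurable_select_mode Suc.IH 3 v) auto
  { case 1 show ?case by fact }
  { case 2 show ?case by fact }
  { case 3 show ?case by fact }
qed

lemma measurable_pdp_path:
  assumes F: "\<And>\<theta>. \<theta> \<in> \<Theta> \<Longrightarrow> (\<lambda>\<nu>. F (\<theta>, \<nu>)) \<in> borel_measurable borel"
    and start: "\<And>\<omega>. \<omega> \<in> space G \<Longrightarrow> ts 0 \<omega> \<le> ereal T"
    and escape: "\<And>\<omega>. \<omega> \<in> space G \<Longrightarrow> \<exists>m. ereal T < ts m \<omega>"
  shows "(\<lambda>\<omega>. F (pdp_path \<Theta> k lamstar \<Phi> lam Q x0 (\<lambda>j. ts j \<omega>) (\<lambda>j. u j \<omega>) (\<lambda>j. v j \<omega>) T)) \<in> borel_measurable G"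
proof -
  let ?\<tau> = "\<lambda>n \<omega>. thin_index \<Phi> (\<lambda>j. ts j \<omega>) (\<lambda>j. u j \<omega>) (\<lambda>j. v j \<omega>) n"
  let ?\<theta> = "\<lambda>n \<omega>. thin_mode \<Phi> (\<lambda>j. ts j \<omega>) (\<lambda>j. u j \<omega>) (\<lambda>j. v j \<omega>) n"
  let ?\<nu> = "\<lambda>n \<omega>. thin_value \<Phi> (\<lambda>j. ts j \<omega>) (\<lambda>j. u j \<omega>) (\<lambda>j. v j \<omega>) n"
  let ?t = "\<lambda>n \<omega>. index_time (\<lambda>j. ts j \<omega>) (?\<tau> n \<omega>)"
  define P where "P n \<omega> \<longleftrightarrow> ?t n \<omega> \<le> ereal T \<and> ereal T < ?t (Suc n) \<omega>" for n \<omega>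
  have t[measurable]: "?t n \<in> borel_measurable G" for n
    by (intro measurable_index_time[of ts, OF ts] measurable_thin)
  have [measurable]: "Measurable.pred G (P n)" for n
    unfolding P_def by measurable
  have ex1: "\<exists>!n. P n \<omega>" if "\<omega> \<in> space G" for \<omega>
    unfolding P_def by (rule ex1_thin_step) (use that ts_mono start escape in auto)
  \<comment> \<open>The number of the current step is itself measurable, which reduces the path at
    \<open>T\<close> to a countable case distinction.\<close>
  define n where "n \<omega> = (THE n. P n \<omega>)" for \<omega>
  have n[measurable]: "n \<in> measurable G (count_space UNIV)"
    unfolding n_def
  proof (rule measurable_THE[where I = UNIV])
    show "i = j" if "\<omega> \<in> space G" "P i \<omega>" "P j \<omega>" for \<omega> i j
      using ex1[OF that(1)] that(2,3) by blast
  qed auto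
  have "(\<lambda>\<omega>. F (?\<theta> i \<omega>, \<Phi> (?\<theta> i \<omega>) (max 0 (real_of_ereal (ereal T - ?t i \<omega>))) (?\<nu> i \<omega>))) \<in> borel_measurable G" for i
    by (rule measurable_on_modes[where f = F, OF measurable_thin(2) _ F])
      (intro measurable_flow[OF \<Phi> measurable_thin(2) _ measurable_thin(3)], measurable)
  from measurable_compose_countable[OF this n]
  have "(\<lambda>\<omega>. F (?\<theta> (n \<omega>) \<omega>, \<Phi> (?\<theta> (n \<omega>) \<omega>) (max 0 (real_of_ereal (ereal T - ?t (n \<omega>) \<omega>))) (?\<nu> (n \<omega>) \<omega>))) \<in> borel_measurable G" .
  also have "?this \<longleftrightarrow> ?thesis"
  proof (rule measurable_cong)
    fix \<omega> assume \<omega>: "\<omega> \<in> space G"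
    have "P (n \<omega>) \<omega>" unfolding n_def using ex1[OF \<omega>] by (rule theI')
    moreover from this have "max 0 (real_of_ereal (ereal T - ?t (n \<omega>) \<omega>)) = real_of_ereal (ereal T - ?t (n \<omega>) \<omega>)"
      by (auto simp: P_def max_def intro: real_of_ereal_pos ereal_diff_positive)
    ultimately show "F (?\<theta> (n \<omega>) \<omega>, \<Phi> (?\<theta> (n \<omega>) \<omega>) (max 0 (real_of_ereal (ereal T - ?t (n \<omega>) \<omega>))) (?\<nu> (n \<omega>) \<omega>))
      = F (pdp_path \<Theta> k lamstar \<Phi> lam Q x0 (\<lambda>j. ts j \<omega>) (\<lambda>j. u j \<omega>) (\<lambda>j. v j \<omega>) T)"
      unfolding P_def by (subst pdp_path_eq[where n = "n \<omega>"]) (use ts_mono \<omega> in auto)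
  qed
  finally show ?thesis .
qed

end

end

section \<open>Pathwise coupling\<close>

lemma elapsed_bounds:
  fixes ts :: "nat \<Rightarrow> ereal"
  assumes "mono ts" "0 \<le> ts 0" "i \<le> j" "ts j \<le> ereal T"
  shows "0 \<le> real_of_ereal (ts j - ts i)" "real_of_ereal (ts j - ts i) \<le> T"
proof -
  have "0 \<le> ts i" "ts i \<le> ts j"
    using assms(1-3) by (auto simp: mono_def intro: order.trans)
  with \<open>ts j \<le> ereal T\<close> show "0 \<le> real_of_ereal (ts j - ts i)" "real_of_ereal (ts j - ts i) \<le> T"
    by (cases "ts i"; cases "ts j"; simp)+
qed

text \<open>Taking \<open>S = T\<close> on every stretch between jumps costs sharpness but gives one
  factor \<open>exp (C1 * T)\<close> for all of them.\<close>

lemma flow_estimateD: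
  assumes "flow_estimate \<Theta> T C1 C2 h \<Phi> \<Psi>" "\<theta> \<in> \<Theta>" "0 < T" "0 \<le> t" "t \<le> T"
  shows "\<bar>\<Phi> \<theta> t a - \<Psi> \<theta> t b\<bar> \<le> exp (C1 * T) * \<bar>a - b\<bar> + C2 * h"
proof -
  have "ereal \<bar>\<Phi> \<theta> t a - \<Psi> \<theta> t b\<bar> \<le> (SUP t\<in>{0..T}. ereal \<bar>\<Phi> \<theta> t a - \<Psi> \<theta> t b\<bar>)"
    using assms(4,5) by (intro SUP_upper) auto
  also have "\<dots> \<le> ereal (exp (C1 * T) * \<bar>a - b\<bar> + C2 * h)"
    using assms(1-3) unfolding flow_estimate_def by auto
  finally show ?thesis by simp
qed

text \<open>
  Truncating the elapsed time at \<open>0\<close> changes nothing for \<open>j\<close> beyond the current index, but makes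
  the value a measurable function for all \<open>j\<close>: flows are measurable only for nonnegative times.
\<close>

definition pre_jump :: "('k \<Rightarrow> real \<Rightarrow> real \<Rightarrow> real) \<Rightarrow> (nat \<Rightarrow> ereal) \<Rightarrow> nat \<Rightarrow> enat \<times> 'k \<times> real \<Rightarrow> real" where
  "pre_jump \<Phi> ts j z =
     \<Phi> (fst (snd z)) (max 0 (real_of_ereal (ts j - ts (the_enat (fst z))))) (snd (snd z))"

text \<open>The last two conjuncts put the candidate \<open>j\<close> after the current index and
  within the horizon. The elapsed time then lies in \<open>{0..T}\<close>, where the flow estimate
  applies, and the event is contained in \<open>j \<le> N T \<omega>\<close>.\<close>

definition coupled :: "real \<Rightarrow> real \<Rightarrow> (nat \<Rightarrow> ereal) \<Rightarrow> nat \<Rightarrow> enat \<times> 'k \<times> real \<Rightarrow> enat \<times> 'k \<times> real \<Rightarrow> bool" where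
  "coupled \<delta> T ts j z z' \<longleftrightarrow> fst z = fst z' \<and> fst (snd z) = fst (snd z') \<and>
     \<bar>snd (snd z) - snd (snd z')\<bar> \<le> \<delta> \<and> fst z < enat j \<and> ts j \<le> ereal T"

text \<open>\<open>K\<close> and \<epsilon> stand for \<open>exp (C1 * T)\<close> and
  \<open>C2 * h\<close>; the step size enters the bounds only through \<epsilon>.\<close>

locale thinning_pair = thinning_modes \<Theta> k lamstar lam Q x0
  for \<Theta> :: "'k set" and k lamstar lam Q x0 +
  fixes \<Phi> \<Psi> :: "'k \<Rightarrow> real \<Rightarrow> real \<Rightarrow> real" and T K \<epsilon> L_lam L_Q :: real
  assumes flow_measurable: "flow_measurable \<Theta> \<Phi>" "flow_measurable \<Theta> \<Psi>"
    and T_pos: "0 < T" and K_nonneg: "0 \<le> K" and \<epsilon>_nonneg: "0 \<le> \<epsilon>"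
    and flow_close: "\<And>\<theta> t a b. \<theta> \<in> \<Theta> \<Longrightarrow> 0 \<le> t \<Longrightarrow> t \<le> T \<Longrightarrow> \<bar>\<Phi> \<theta> t a - \<Psi> \<theta> t b\<bar> \<le> K * \<bar>a - b\<bar> + \<epsilon>"
    and lam_lipschitz: "\<And>\<theta> a b. \<theta> \<in> \<Theta> \<Longrightarrow> \<bar>lam (\<theta>, a) - lam (\<theta>, b)\<bar> \<le> L_lam * \<bar>a - b\<bar>"
    and mode_prob_lipschitz:
      "\<And>\<theta> A a b. \<theta> \<in> \<Theta> \<Longrightarrow> A \<subseteq> \<Theta> \<Longrightarrow> \<bar>mode_prob Q (\<theta>, a) A - mode_prob Q (\<theta>, b) A\<bar> \<le> L_Q * \<bar>a - b\<bar>"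
    and L_nonneg: "0 \<le> L_lam" "0 \<le> L_Q"
begin

text \<open>One stretch of flow turns a gap d into at most K d + \<epsilon>. Starting from
  \<epsilon> instead of 0 keeps \<epsilon> below \<open>dev n\<close>, so the additive error is
  absorbed by raising the factor from \<open>K\<close> to \<open>K + 1\<close>.\<close>

definition dev :: "nat \<Rightarrow> real" where "dev n = \<epsilon> * (K + 1) ^ n"

lemma dev_nonneg: "0 \<le> dev n"
  using K_nonneg \<epsilon>_nonneg by (simp add: dev_def)

lemma dev_mono: "m \<le> n \<Longrightarrow> dev m \<le> dev n"
  unfolding dev_def using K_nonneg \<epsilon>_nonneg by (intro mult_left_mono power_increasing) auto

lemma flow_dev:
  assumes "\<theta> \<in> \<Theta>" "0 \<le> t" "t \<le> T" "\<bar>a - b\<bar> \<le> dev n"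
  shows "\<bar>\<Phi> \<theta> t a - \<Psi> \<theta> t b\<bar> \<le> dev (Suc n)"
proof -
  have "\<bar>\<Phi> \<theta> t a - \<Psi> \<theta> t b\<bar> \<le> K * dev n + \<epsilon>"
    using flow_close[OF assms(1-3), of a b] mult_left_mono[OF assms(4) K_nonneg] by linarith
  moreover have "\<epsilon> \<le> dev n"
    using dev_mono[of 0 n] by (simp add: dev_def)
  moreover have "dev (Suc n) = K * dev n + dev n"
    by (simp add: dev_def algebra_simps)
  ultimately show ?thesis by linarith
qed

text \<open>A cumulative probability adds up at most \<open>card \<Theta>\<close> one-mode
  probabilities, each \<open>L_Q\<close>-Lipschitz.\<close>

lemma cum_prob_lipschitz:
  assumes "\<theta> \<in> \<Theta>" "i \<le> card \<Theta>"
  shows "\<bar>cum_prob k Q i (\<theta>, a) - cum_prob k Q i (\<theta>, b)\<bar> \<le> card \<Theta> * L_Q * \<bar>a - b\<bar>"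
proof -
  have "\<bar>cum_prob k Q i (\<theta>, a) - cum_prob k Q i (\<theta>, b)\<bar>
    \<le> (\<Sum>j=1..i. \<bar>mode_prob Q (\<theta>, a) {k j} - mode_prob Q (\<theta>, b) {k j}\<bar>)"
    unfolding cum_prob_def sum_subtractf[symmetric] by (rule sum_abs)
  also have "\<dots> \<le> (\<Sum>j=1..i. L_Q * \<bar>a - b\<bar>)"
    using assms enum_in by (intro sum_mono mode_prob_lipschitz) auto
  also have "\<dots> \<le> card \<Theta> * L_Q * \<bar>a - b\<bar>"
    using assms(2) L_nonneg by (simp add: mult_right_mono mult.assoc)
  finally show ?thesis .
qed

lemma pre_jump_dev:
  assumes c: "coupled (dev n) T ts j z z'" and "mono ts" "0 \<le> ts 0" and "fst (snd z) \<in> \<Theta>"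
  shows "\<bar>pre_jump \<Phi> ts j z - pre_jump \<Psi> ts j z'\<bar> \<le> dev (Suc n)"
proof -
  obtain m where m: "fst z = enat m" "m < j" using c by (cases "fst z") (auto simp: coupled_def)
  have "0 \<le> real_of_ereal (ts j - ts m)" "real_of_ereal (ts j - ts m) \<le> T"
    using elapsed_bounds[OF assms(2,3), of m j T] m c by (auto simp: coupled_def)
  then have "\<bar>\<Phi> (fst (snd z)) (max 0 (real_of_ereal (ts j - ts m))) (snd (snd z))
      - \<Psi> (fst (snd z)) (max 0 (real_of_ereal (ts j - ts m))) (snd (snd z'))\<bar> \<le> dev (Suc n)"
    using c assms(4) by (intro flow_dev) (auto simp: coupled_def)
  moreover have "fst z' = enat m" "fst (snd z') = fst (snd z)" using c m by (auto simp: coupled_def)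
  ultimately show ?thesis by (simp add: pre_jump_def m(1))
qed

text \<open>
  \<open>n\<close> counts the jumps made so far and \<open>j > \<tau>\<^sub>n\<close> is a candidate for \<open>\<tau>\<^sub>n\<^sub>+\<^sub>1\<close>, not necessarily the
  accepted one.  Ranging over all pairs keeps \<open>j\<close> deterministic, so that the mode
  variable \<open>V\<^sub>n\<^sub>+\<^sub>1\<close> never has a random index.
\<close>

definition rate_mismatch where
  "rate_mismatch ts u v n j \<longleftrightarrow>
     (let z = thin \<Phi> ts u v n; z' = thin \<Psi> ts u v n in
      coupled (dev n) T ts j z z' \<and>
      (u j * lamstar \<le> lam (fst (snd z), pre_jump \<Phi> ts j z)) \<noteq>
      (u j * lamstar \<le> lam (fst (snd z'), pre_jump \<Psi> ts j z')))"

definition mode_mismatch where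
  "mode_mismatch ts u v n j \<longleftrightarrow>
     (let z = thin \<Phi> ts u v n; z' = thin \<Psi> ts u v n in
      coupled (dev n) T ts j z z' \<and>
      select_mode \<Theta> k Q (fst (snd z), pre_jump \<Phi> ts j z) (v (Suc n)) \<noteq>
      select_mode \<Theta> k Q (fst (snd z'), pre_jump \<Psi> ts j z') (v (Suc n)))"

lemma coupled_thin_less: "coupled \<delta> T ts j (thin \<Phi> ts u v n) z' \<Longrightarrow> n < j"
  using thin_index_ge[of n \<Phi> ts u v] by (auto simp: coupled_def dest: le_less_trans)

context
  fixes ts :: "nat \<Rightarrow> ereal" and u v :: "nat \<Rightarrow> real" and N :: nat
  assumes ts_mono: "mono ts" and ts_0: "ts 0 = 0"
    and count: "\<And>j. ts j \<le> ereal T \<longleftrightarrow> j \<le> N"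
    and no_mismatch: "\<And>n j. \<not> rate_mismatch ts u v n j" "\<And>n j. \<not> mode_mismatch ts u v n j"
begin

definition synced where
  "synced n \<longleftrightarrow> thin_index \<Phi> ts u v n = thin_index \<Psi> ts u v n \<and>
     thin_mode \<Phi> ts u v n = thin_mode \<Psi> ts u v n \<and>
     \<bar>thin_value \<Phi> ts u v n - thin_value \<Psi> ts u v n\<bar> \<le> dev n"

lemma synced_coupled:
  "synced n \<Longrightarrow> thin_index \<Phi> ts u v n < enat j \<Longrightarrow> j \<le> N
    \<Longrightarrow> coupled (dev n) T ts j (thin \<Phi> ts u v n) (thin \<Psi> ts u v n)"
  by (simp add: synced_def coupled_def count)

lemma pre_jump_eq:
  assumes "fst z < enat j" "j \<le> N"
  shows "pre_jump \<Phi>' ts j z = \<Phi>' (fst (snd z)) (real_of_ereal (ts j - ts (the_enat (fst z)))) (snd (snd z))"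
proof -
  obtain m where m: "fst z = enat m" "m < j" using assms by (cases "fst z") auto
  then have "0 \<le> real_of_ereal (ts j - ts m)"
    using elapsed_bounds(1)[OF ts_mono, of m j T] ts_0 assms by (auto simp: count)
  then show ?thesis using m by (simp add: pre_jump_def)
qed

text \<open>The flows are known to be close only within the horizon, hence the restriction to
  indices up to \<open>N\<close>. Equal tests at all candidates up to \<open>j\<close> give the same
  first acceptance.\<close>

lemma synced_next_index:
  assumes "synced n" "j \<le> N"
  shows "thin_index \<Phi> ts u v (Suc n) = enat j \<longleftrightarrow> thin_index \<Psi> ts u v (Suc n) = enat j"
proof -
  have i: "thin_index \<Psi> ts u v n = thin_index \<Phi> ts u v n" using assms(1) by (simp add: synced_def)
  have "u i * lamstar \<le> lam (thin_mode \<Phi> ts u v n, \<Phi> (thin_mode \<Phi> ts u v n)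
        (real_of_ereal (ts i - ts (the_enat (thin_index \<Phi> ts u v n)))) (thin_value \<Phi> ts u v n)) \<longleftrightarrow>
      u i * lamstar \<le> lam (thin_mode \<Psi> ts u v n, \<Psi> (thin_mode \<Psi> ts u v n)
        (real_of_ereal (ts i - ts (the_enat (thin_index \<Phi> ts u v n)))) (thin_value \<Psi> ts u v n))"
    if "thin_index \<Phi> ts u v n < enat i" "i \<le> j" for i
    using no_mismatch(1)[of n i] synced_coupled[OF assms(1) that(1)] that assms(2)
    by (simp add: rate_mismatch_def Let_def pre_jump_eq i)
  then show ?thesis
    unfolding thin_index_Suc next_index_eq_enat_iff i by (metis order_refl less_imp_le)
qed

lemma synced_Suc:
  assumes "synced n" "j \<le> N" and j: "thin_index \<Phi> ts u v (Suc n) = enat j"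
  shows "synced (Suc n)"
proof -
  let ?z = "thin \<Phi> ts u v n" and ?z' = "thin \<Psi> ts u v n"
  have j': "thin_index \<Psi> ts u v (Suc n) = enat j" using synced_next_index assms by blast
  have less: "thin_index \<Phi> ts u v n < enat j"
    using j unfolding thin_index_Suc next_index_eq_enat_iff by blast
  have i: "thin_index \<Psi> ts u v n = thin_index \<Phi> ts u v n" using assms(1) by (simp add: synced_def)
  obtain m where m: "thin_index \<Phi> ts u v n = enat m" using less by (cases "thin_index \<Phi> ts u v n") auto
  have c: "coupled (dev n) T ts j ?z ?z'" by (rule synced_coupled[OF assms(1) less assms(2)])
  \<comment> \<open>At the accepted index the candidate value becomes the new state, so the bound
    and the absence of mismatches for candidates carry over to the recursion.\<close>
  have val: "thin_value \<Phi> ts u v (Suc n) = pre_jump \<Phi> ts j ?z"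
    "thin_value \<Psi> ts u v (Suc n) = pre_jump \<Psi> ts j ?z'"
    unfolding thin_value_Suc j j' using less assms(2) m
    by (simp_all add: pre_jump_eq i index_time_def)
  have "thin_mode \<Phi> ts u v (Suc n) = thin_mode \<Psi> ts u v (Suc n)"
    unfolding thin_mode_Suc val using no_mismatch(2)[of n j] c by (simp add: mode_mismatch_def Let_def)
  moreover have "\<bar>thin_value \<Phi> ts u v (Suc n) - thin_value \<Psi> ts u v (Suc n)\<bar> \<le> dev (Suc n)"
    unfolding val by (rule pre_jump_dev[OF c ts_mono]) (simp_all add: ts_0 thin_mode_in)
  ultimately show ?thesis by (simp add: synced_def j j')
qed

lemma index_time_le_iff: "index_time ts \<tau> \<le> ereal T \<longleftrightarrow> (\<exists>j\<le>N. \<tau> = enat j)"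
  by (cases \<tau>) (auto simp: index_time_def count)

text \<open>At most \<open>N\<close> jumps occur up to \<open>T\<close>; \<open>Suc\<close> pays for
  the last stretch of flow from the final jump to \<open>T\<close>.\<close>

lemma pdp_path_close:
  defines "y \<equiv> pdp_path \<Theta> k lamstar \<Phi> lam Q x0 ts u v T"
    and "y' \<equiv> pdp_path \<Theta> k lamstar \<Psi> lam Q x0 ts u v T"
  shows "fst y = fst y'" "\<bar>snd y - snd y'\<bar> \<le> dev (Suc N)"
proof -
  have "\<exists>!n. index_time ts (thin_index \<Phi> ts u v n) \<le> ereal T \<and> ereal T < index_time ts (thin_index \<Phi> ts u v (Suc n))"
    by (rule ex1_thin_step[OF ts_mono])
      (use ts_0 T_pos count[of "Suc N"] in \<open>auto simp: not_le[symmetric]\<close>)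
  then obtain n where n: "index_time ts (thin_index \<Phi> ts u v n) \<le> ereal T"
      "ereal T < index_time ts (thin_index \<Phi> ts u v (Suc n))"
    by blast
  have "synced i" if "i \<le> n" for i
    using that
  proof (induction i)
    case 0
    then show ?case using dev_nonneg by (simp add: synced_def)
  next
    case (Suc i)
    have "index_time ts (thin_index \<Phi> ts u v (Suc i)) \<le> ereal T"
      using index_time_thin_mono[OF ts_mono Suc.prems] n(1) by (rule order.trans)
    then show ?case using Suc synced_Suc[of i] by (auto simp: index_time_le_iff)
  qed
  then have s: "synced n" by simp
  obtain j where j: "thin_index \<Phi> ts u v n = enat j" "j \<le> N" using n(1) by (auto simp: index_time_le_iff)
  have j': "thin_index \<Psi> ts u v n = enat j" using s j by (simp add: synced_def)
  have n': "index_time ts (thin_index \<Psi> ts u v n) \<le> ereal T" using j j' by (auto simp: index_time_le_iff)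
  \<comment> \<open>A further jump of the \<Psi>-process up to \<open>T\<close> would have an index
    at most \<open>N\<close>, and by agreement there the \<Phi>-process would jump too.\<close>
  have "\<not> index_time ts (thin_index \<Psi> ts u v (Suc n)) \<le> ereal T"
  proof
    assume "index_time ts (thin_index \<Psi> ts u v (Suc n)) \<le> ereal T"
    then obtain i where "i \<le> N" "thin_index \<Psi> ts u v (Suc n) = enat i" by (auto simp: index_time_le_iff)
    then have "thin_index \<Phi> ts u v (Suc n) = enat i" using synced_next_index[OF s] by blast
    then show False using n(2) \<open>i \<le> N\<close> index_time_le_iff by (metis not_le)
  qed
  then have n'': "ereal T < index_time ts (thin_index \<Psi> ts u v (Suc n))" by simp
  have y: "y = (thin_mode \<Phi> ts u v n, \<Phi> (thin_mode \<Phi> ts u v n) (real_of_ereal (ereal T - ts j)) (thin_value \<Phi> ts u v n))"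
    unfolding y_def by (subst pdp_path_eq[OF ts_mono n]) (simp add: j index_time_def)
  have y': "y' = (thin_mode \<Phi> ts u v n, \<Psi> (thin_mode \<Phi> ts u v n) (real_of_ereal (ereal T - ts j)) (thin_value \<Psi> ts u v n))"
    unfolding y'_def by (subst pdp_path_eq[OF ts_mono n' n'']) (use s in \<open>simp add: j' index_time_def synced_def\<close>)
  show "fst y = fst y'" by (simp add: y y')
  have "0 \<le> ts j" using ts_mono ts_0 by (metis mono_def le0)
  moreover have "ts j \<le> ereal T" using j(2) count by simp
  ultimately have "0 \<le> real_of_ereal (ereal T - ts j)" "real_of_ereal (ereal T - ts j) \<le> T"
    by (cases "ts j"; simp)+
  then have "\<bar>snd y - snd y'\<bar> \<le> dev (Suc n)"
    unfolding y y' snd_conv using s by (intro flow_dev) (auto simp: thin_mode_in synced_def)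
  also have "n \<le> j" using thin_index_ge[of n \<Phi> ts u v] j by simp
  then have "dev (Suc n) \<le> dev (Suc N)" using j by (intro dev_mono) auto
  finally show "\<bar>snd y - snd y'\<bar> \<le> dev (Suc N)" .
qed

end

end

section \<open>Jump times and moments of the Poisson process\<close>

lemma mono_jump_time: "mono (\<lambda>j. jump_time N j \<omega>)"
  unfolding jump_time_def by (intro monoI INF_superset_mono) auto

lemma jump_time_0: "jump_time N 0 \<omega> = 0"
proof (rule antisym)
  show "jump_time N 0 \<omega> \<le> 0"
    unfolding jump_time_def by (rule INF_lower2[of 0]) auto
  show "0 \<le> jump_time N 0 \<omega>"
    unfolding jump_time_def by (rule INF_greatest) auto
qed

text \<open>The point is that the infimum is attained: an integer-valued right-continuous path is
  constant just after \<open>t\<close>, so a level reached arbitrarily soon after \<open>t\<close>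
  is already reached at \<open>t\<close>.\<close>

lemma (in prob_space) jump_time_le_iff:
  assumes N: "poisson_process rate N" and \<omega>: "\<omega> \<in> space M" and "0 \<le> t"
  shows "jump_time N j \<omega> \<le> ereal t \<longleftrightarrow> j \<le> N t \<omega>"
proof
  assume "j \<le> N t \<omega>"
  then show "jump_time N j \<omega> \<le> ereal t"
    unfolding jump_time_def using \<open>0 \<le> t\<close> by (intro INF_lower) auto
next
  assume le: "jump_time N j \<omega> \<le> ereal t"
  have mono: "mono_on {0..} (\<lambda>t. N t \<omega>)" and cont: "continuous (at_right t) (\<lambda>s. N s \<omega>)"
    using N \<omega> \<open>0 \<le> t\<close> unfolding poisson_process_def by auto
  from cont have "eventually (\<lambda>s. N s \<omega> = N t \<omega>) (at_right t)"
    by (simp add: continuous_within tendsto_discrete)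
  then obtain b where b: "t < b" "\<And>s. t < s \<Longrightarrow> s < b \<Longrightarrow> N s \<omega> = N t \<omega>"
    unfolding eventually_at_right_field by auto
  have "jump_time N j \<omega> < ereal b" using le b(1) by (auto intro: le_less_trans)
  then obtain s where s: "0 \<le> s" "j \<le> N s \<omega>" "s < b"
    unfolding jump_time_def INF_less_iff by auto
  show "j \<le> N t \<omega>"
  proof (cases "t < s")
    case True
    then show ?thesis using b(2)[of s] s by simp
  next
    case False
    then have "N s \<omega> \<le> N t \<omega>" using s(1) \<open>0 \<le> t\<close> by (intro mono_onD[OF mono]) auto
    then show ?thesis using s(2) by simp
  qed
qed

text \<open>Up to the factor \<open>exp (- \<mu>)\<close> the series of absolute values is the
  exponential series at \<open>\<mu> * \<bar>r\<bar>\<close>.\<close>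

lemma integrable_power_poisson:
  assumes "0 < \<mu>"
  shows "integrable (measure_pmf (poisson_pmf \<mu>)) (\<lambda>n. r ^ n :: real)"
proof -
  have "summable (\<lambda>n. exp (- \<mu>) * (inverse (fact n) * (\<mu> * \<bar>r\<bar>) ^ n))"
    by (intro summable_mult summable_exp)
  also have "(\<lambda>n. exp (- \<mu>) * (inverse (fact n) * (\<mu> * \<bar>r\<bar>) ^ n)) = (\<lambda>n. norm (pmf (poisson_pmf \<mu>) n *\<^sub>R r ^ n))"
    using assms by (auto simp: fun_eq_iff abs_mult power_abs power_mult_distrib field_simps)
  finally show ?thesis
    by (subst measure_pmf_eq_density, subst integrable_density)
      (auto simp: integrable_count_space_nat_iff)
qed

context thinning_data
begin

lemma N_measurable: "0 \<le> t \<Longrightarrow> N t \<in> measurable M (count_space UNIV)"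
  using poisson by (simp add: poisson_process_def)

lemma distr_N:
  assumes "0 < t"
  shows "distr M (count_space UNIV) (N t) = measure_pmf (poisson_pmf (lamstar * t))"
proof -
  have "distr M (count_space UNIV) (\<lambda>\<omega>. N t \<omega> - N 0 \<omega>) = measure_pmf (poisson_pmf (lamstar * (t - 0)))"
    using poisson assms unfolding poisson_process_def by blast
  moreover have "distr M (count_space UNIV) (\<lambda>\<omega>. N t \<omega> - N 0 \<omega>) = distr M (count_space UNIV) (N t)"
    using poisson by (intro distr_cong) (auto simp: poisson_process_def)
  ultimately show ?thesis by simp
qed

lemma integrable_power_N:
  assumes "0 < t" "0 < lamstar"
  shows "integrable M (\<lambda>\<omega>. r ^ N t \<omega> :: real)"
proof -
  have "integrable (distr M (count_space UNIV) (N t)) (\<lambda>n. r ^ n)"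
    unfolding distr_N[OF assms(1)] using assms by (intro integrable_power_poisson) auto
  then show ?thesis
    using assms by (subst (asm) integrable_distr_eq) (auto intro: N_measurable)
qed

text \<open>Markov's inequality for \<open>r ^ N t \<omega>\<close>. The base stays free so that it
  can be chosen to outgrow \<open>dev j\<close>.\<close>

lemma prob_N_ge:
  assumes "0 < t" "0 < lamstar" "1 \<le> r"
  shows "prob {\<omega>\<in>space M. j \<le> N t \<omega>} \<le> expectation (\<lambda>\<omega>. r ^ N t \<omega>) / r ^ j"
proof -
  have [measurable]: "N t \<in> measurable M (count_space UNIV)" using assms by (intro N_measurable) auto
  have "prob {\<omega>\<in>space M. j \<le> N t \<omega>} \<le> prob {\<omega>\<in>space M. r ^ j \<le> r ^ N t \<omega>}"
    using assms by (intro finite_measure_mono) (auto intro: power_increasing)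
  also have "\<dots> \<le> expectation (\<lambda>\<omega>. r ^ N t \<omega>) / r ^ j"
    using assms by (intro integral_Markov_inequality_measure[where A = "space M" and u = "\<lambda>\<omega>. r ^ N t \<omega>", simplified] integrable_power_N)
      (auto intro: AE_I2)
  finally show ?thesis .
qed

lemma generated_events_subset:
  "generated_events U \<subseteq> events" "generated_events V \<subseteq> events" "generated_events (jump_time N) \<subseteq> events"
proof -
  have "[generated_events U, generated_events V, generated_events (jump_time N)] ! i \<subseteq> events" if "i < 3" for i
    using indep_UVT that unfolding indep_sets_def by blast
  from this[of 0] this[of 1] this[of 2] show
    "generated_events U \<subseteq> events" "generated_events V \<subseteq> events" "generated_events (jump_time N) \<subseteq> events"
    by simp_all
qed

lemma prob_Int_generated:
  assumes "A \<in> generated_events U" "B \<in> generated_events V" "C \<in> generated_events (jump_time N)"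
  shows "prob (A \<inter> B \<inter> C) = prob A * prob B * prob C"
proof -
  have 3: "{..<3} = {0, 1, 2::nat}" by auto
  have "prob (\<Inter>i\<in>{..<3}. [A, B, C] ! i) = (\<Prod>i\<in>{..<3}. prob ([A, B, C] ! i))"
    by (rule indep_setsD[OF indep_UVT]) (use assms in \<open>auto simp: 3\<close>)
  then show ?thesis by (simp add: 3 Int_assoc mult.assoc)
qed

lemma data_measurable:
  assumes "1 \<le> i"
  shows "U i \<in> borel_measurable M" "V i \<in> borel_measurable M" "jump_time N i \<in> borel_measurable M"
  using generated_events_subset generated_eventsI[OF assms, of _ U] generated_eventsI[OF assms, of _ V]
    generated_eventsI[OF assms, of _ "jump_time N"]
  by (auto intro!: measurableI)

end

section \<open>Probability of a mismatch\<close>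

lemma sets_eq_count_space:
  assumes f: "f \<in> measurable G (count_space I)" and g: "g \<in> measurable G (count_space I)" and I: "countable I"
  shows "{\<omega>\<in>space G. f \<omega> = g \<omega>} \<in> sets G"
proof -
  have "{\<omega>\<in>space G. f \<omega> = g \<omega>} = (\<Union>a\<in>I. (f -` {a} \<inter> space G) \<inter> (g -` {a} \<inter> space G))"
    using measurable_space[OF f] measurable_space[OF g] by auto
  also have "\<dots> \<in> sets G"
    by (intro sets.countable_UN'' I sets.Int measurable_sets[OF f] measurable_sets[OF g]) auto
  finally show ?thesis .
qed

context thinning_pair
begin

context
  fixes G :: "'w measure" and ts :: "nat \<Rightarrow> 'w \<Rightarrow> ereal" and u v :: "nat \<Rightarrow> 'w \<Rightarrow> real"
  assumes ts: "\<And>j. ts j \<in> borel_measurable G"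
    and u: "\<And>j. 1 \<le> j \<Longrightarrow> u j \<in> borel_measurable G" and v: "\<And>j. 1 \<le> j \<Longrightarrow> v j \<in> borel_measurable G"
    and ts_mono: "\<And>\<omega>. \<omega> \<in> space G \<Longrightarrow> mono (\<lambda>j. ts j \<omega>)"
begin

lemma measurable_pre_jump:
  assumes \<Phi>': "flow_measurable \<Theta> \<Phi>'"
  shows "(\<lambda>\<omega>. pre_jump \<Phi>' (\<lambda>j. ts j \<omega>) j (thin \<Phi>' (\<lambda>j. ts j \<omega>) (\<lambda>j. u j \<omega>) (\<lambda>j. v j \<omega>) n)) \<in> borel_measurable G"
  unfolding pre_jump_def
  by (intro measurable_flow[OF \<Phi>'] measurable_thin[OF \<Phi>'] measurable_elapsed[of ts] ts u v ts_mono)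

lemma measurable_at_pre_jump:
  assumes \<Phi>': "flow_measurable \<Theta> \<Phi>'"
    and f: "\<And>\<theta>. \<theta> \<in> \<Theta> \<Longrightarrow> (\<lambda>\<nu>. f (\<theta>, \<nu>)) \<in> borel_measurable borel"
  shows "(\<lambda>\<omega>. f (thin_mode \<Phi>' (\<lambda>j. ts j \<omega>) (\<lambda>j. u j \<omega>) (\<lambda>j. v j \<omega>) n,
    pre_jump \<Phi>' (\<lambda>j. ts j \<omega>) j (thin \<Phi>' (\<lambda>j. ts j \<omega>) (\<lambda>j. u j \<omega>) (\<lambda>j. v j \<omega>) n))) \<in> borel_measurable G"
  by (rule measurable_on_modes[where f = f, OF measurable_thin(2)[OF \<Phi>' ts u v ts_mono] measurable_pre_jump[OF \<Phi>'] f])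

lemma coupled_sets:
  "{\<omega>\<in>space G. coupled \<delta> T (\<lambda>j. ts j \<omega>) j (thin \<Phi> (\<lambda>j. ts j \<omega>) (\<lambda>j. u j \<omega>) (\<lambda>j. v j \<omega>) n)
     (thin \<Psi> (\<lambda>j. ts j \<omega>) (\<lambda>j. u j \<omega>) (\<lambda>j. v j \<omega>) n)} \<in> sets G"
proof -
  let ?z = "\<lambda>\<omega>. thin \<Phi> (\<lambda>j. ts j \<omega>) (\<lambda>j. u j \<omega>) (\<lambda>j. v j \<omega>) n"
  let ?z' = "\<lambda>\<omega>. thin \<Psi> (\<lambda>j. ts j \<omega>) (\<lambda>j. u j \<omega>) (\<lambda>j. v j \<omega>) n"
  have i: "(\<lambda>\<omega>. fst (?z \<omega>)) \<in> measurable G (count_space UNIV)"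
    "(\<lambda>\<omega>. fst (?z' \<omega>)) \<in> measurable G (count_space UNIV)"
    and m: "(\<lambda>\<omega>. fst (snd (?z \<omega>))) \<in> measurable G (count_space \<Theta>)"
    "(\<lambda>\<omega>. fst (snd (?z' \<omega>))) \<in> measurable G (count_space \<Theta>)"
    and w: "(\<lambda>\<omega>. snd (snd (?z \<omega>))) \<in> borel_measurable G" "(\<lambda>\<omega>. snd (snd (?z' \<omega>))) \<in> borel_measurable G"
    by (rule measurable_thin[OF flow_measurable(1) ts u v ts_mono]
        measurable_thin[OF flow_measurable(2) ts u v ts_mono]; assumption)+
  note [measurable] = w i(1) ts[of j]
  have [measurable]: "Measurable.pred G (\<lambda>\<omega>. fst (?z \<omega>) = fst (?z' \<omega>))"
    unfolding pred_def by (rule sets_eq_count_space[OF i]) simp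
  have [measurable]: "Measurable.pred G (\<lambda>\<omega>. fst (snd (?z \<omega>)) = fst (snd (?z' \<omega>)))"
    unfolding pred_def by (rule sets_eq_count_space[OF m]) (rule countable_finite[OF finite_modes])
  show ?thesis unfolding coupled_def by measurable
qed

end

end

locale coupled_pdps = thinning_pair \<Theta> k lamstar lam Q x0 \<Phi> \<Psi> T K \<epsilon> L_lam L_Q + thinning_data M lamstar N U V
  for \<Theta> :: "'k set" and k lamstar lam Q x0 \<Phi> \<Psi> T K \<epsilon> L_lam L_Q and M :: "'w measure" and N U V
begin

abbreviation (input) jt where "jt \<omega> \<equiv> (\<lambda>j. jump_time N j \<omega>)"

text \<open>After division by \<open>lamstar\<close> the acceptance test reads
  \<open>U j \<le> a \<omega>\<close>, so this is a threshold mismatch whose gap is controlled by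
  \<open>lam_lipschitz\<close> and \<open>pre_jump_dev\<close>.\<close>

lemma prob_rate_mismatch:
  assumes j: "1 \<le> j"
  shows "\<exists>E\<in>events. {\<omega>\<in>space M. rate_mismatch (jt \<omega>) (\<lambda>i. U i \<omega>) (\<lambda>i. V i \<omega>) n j} \<subseteq> E \<and>
    prob E \<le> L_lam * dev (Suc n) / lamstar * prob {\<omega>\<in>space M. j \<le> N T \<omega>}"
proof -
  obtain G where G: "space G = space M" "sets G \<subseteq> events"
    and U: "\<And>i. 1 \<le> i \<Longrightarrow> i \<noteq> j \<Longrightarrow> U i \<in> borel_measurable G"
    and V: "\<And>i. 1 \<le> i \<Longrightarrow> V i \<in> borel_measurable G"
    and J: "\<And>i. 1 \<le> i \<Longrightarrow> jump_time N i \<in> borel_measurable G"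
    and ind: "\<And>A B. A \<in> sets borel \<Longrightarrow> B \<in> sets G
      \<Longrightarrow> prob (U j -` A \<inter> space M \<inter> B) = prob (U j -` A \<inter> space M) * prob B"
    using ex_complementary_sigma_algebra[OF indep_U generated_events_subset(2,3) prob_Int_generated j] by blast
  have J': "jump_time N i \<in> borel_measurable G" for i
    using J[of i] by (cases "i = 0") (auto simp: jump_time_0[abs_def])
  \<comment> \<open>With \<open>U j\<close> frozen, the states and thus both thresholds are
    measurable for \<open>G\<close>, which is independent of \<open>U j\<close>.\<close>
  let ?u = "\<lambda>i \<omega>. (U(j := (\<lambda>_. 0))) i \<omega>"
  have u: "?u i \<in> borel_measurable G" if "1 \<le> i" for i
    using that U by auto
  have u_eq: "(\<lambda>i. ?u i \<omega>) = (\<lambda>i. U i \<omega>)(j := 0)" for \<omega> by auto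
  let ?z = "\<lambda>\<omega>. thin \<Phi> (jt \<omega>) (\<lambda>i. ?u i \<omega>) (\<lambda>i. V i \<omega>) n"
  let ?z' = "\<lambda>\<omega>. thin \<Psi> (jt \<omega>) (\<lambda>i. ?u i \<omega>) (\<lambda>i. V i \<omega>) n"
  define a where "a \<omega> = lam (fst (snd (?z \<omega>)), pre_jump \<Phi> (jt \<omega>) j (?z \<omega>)) / lamstar" for \<omega>
  define b where "b \<omega> = lam (fst (snd (?z' \<omega>)), pre_jump \<Psi> (jt \<omega>) j (?z' \<omega>)) / lamstar" for \<omega>
  define A where "A = {\<omega>\<in>space G. coupled (dev n) T (jt \<omega>) j (?z \<omega>) (?z' \<omega>)}"
  have a: "a \<in> borel_measurable G" "b \<in> borel_measurable G"
    unfolding a_def b_def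
    by (intro borel_measurable_divide borel_measurable_const
        measurable_at_pre_jump[where f = lam, OF J' u V mono_jump_time _ lam_measurable] flow_measurable; assumption)+
  have A: "A \<in> sets G"
    unfolding A_def by (rule coupled_sets[OF J' u V mono_jump_time])
  have ab: "\<bar>a \<omega> - b \<omega>\<bar> \<le> L_lam * dev (Suc n) / lamstar" if "\<omega> \<in> A" for \<omega>
  proof -
    have c: "coupled (dev n) T (jt \<omega>) j (?z \<omega>) (?z' \<omega>)" using that by (simp only: A_def mem_Collect_eq)
    then have eq: "fst (snd (?z' \<omega>)) = fst (snd (?z \<omega>))" unfolding coupled_def by metis
    have "\<bar>pre_jump \<Phi> (jt \<omega>) j (?z \<omega>) - pre_jump \<Psi> (jt \<omega>) j (?z' \<omega>)\<bar> \<le> dev (Suc n)"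
      by (rule pre_jump_dev[OF c mono_jump_time]) (auto simp: jump_time_0 thin_mode_in)
    then have "L_lam * \<bar>pre_jump \<Phi> (jt \<omega>) j (?z \<omega>) - pre_jump \<Psi> (jt \<omega>) j (?z' \<omega>)\<bar> \<le> L_lam * dev (Suc n)"
      using L_nonneg by (intro mult_left_mono)
    then have "\<bar>lam (fst (snd (?z \<omega>)), pre_jump \<Phi> (jt \<omega>) j (?z \<omega>))
        - lam (fst (snd (?z \<omega>)), pre_jump \<Psi> (jt \<omega>) j (?z' \<omega>))\<bar> \<le> L_lam * dev (Suc n)"
      by (rule order.trans[OF lam_lipschitz[OF thin_mode_in]])
    then show ?thesis
      unfolding a_def b_def eq diff_divide_distrib[symmetric] using lamstar_pos
      by (simp only: abs_divide abs_of_pos) (intro divide_right_mono, auto)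
  qed
  let ?E = "{\<omega>\<in>space M. \<omega> \<in> A \<and> (U j \<omega> \<le> a \<omega>) \<noteq> (U j \<omega> \<le> b \<omega>)}"
  have \<delta>: "0 \<le> L_lam * dev (Suc n) / lamstar" using L_nonneg dev_nonneg[of "Suc n"] lamstar_pos by simp
  note E = prob_threshold_mismatch[OF data_measurable(1)[OF j] G ind uniform_U[OF j] a A ab \<delta>]
  show ?thesis
  proof (intro bexI[of _ ?E] conjI)
    show "?E \<in> events" by (rule E(1))
    \<comment> \<open>The horizon condition inside \<open>coupled\<close> supplies the factor that
      decays in \<open>j\<close>.\<close>
    have "A \<subseteq> {\<omega>\<in>space M. j \<le> N T \<omega>}"
      using T_pos jump_time_le_iff[OF poisson] by (auto simp: A_def coupled_def G(1))
    then have "prob A \<le> prob {\<omega>\<in>space M. j \<le> N T \<omega>}"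
      using N_measurable[of T] T_pos by (intro finite_measure_mono) auto
    then show "prob ?E \<le> L_lam * dev (Suc n) / lamstar * prob {\<omega>\<in>space M. j \<le> N T \<omega>}"
      using E(2) mult_left_mono[OF _ \<delta>] by (meson order.trans)
    show "{\<omega>\<in>space M. rate_mismatch (jt \<omega>) (\<lambda>i. U i \<omega>) (\<lambda>i. V i \<omega>) n j} \<subseteq> ?E"
    proof
      fix \<omega> assume "\<omega> \<in> {\<omega>\<in>space M. rate_mismatch (jt \<omega>) (\<lambda>i. U i \<omega>) (\<lambda>i. V i \<omega>) n j}"
      then have \<omega>: "\<omega> \<in> space M" and r: "rate_mismatch (jt \<omega>) (\<lambda>i. U i \<omega>) (\<lambda>i. V i \<omega>) n j" by auto
      from r have l: "thin_index \<Phi> (jt \<omega>) (\<lambda>i. U i \<omega>) (\<lambda>i. V i \<omega>) n < enat j"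
        "thin_index \<Psi> (jt \<omega>) (\<lambda>i. U i \<omega>) (\<lambda>i. V i \<omega>) n < enat j"
        by (auto simp: rate_mismatch_def coupled_def Let_def)
      have z: "?z \<omega> = thin \<Phi> (jt \<omega>) (\<lambda>i. U i \<omega>) (\<lambda>i. V i \<omega>) n"
        "?z' \<omega> = thin \<Psi> (jt \<omega>) (\<lambda>i. U i \<omega>) (\<lambda>i. V i \<omega>) n"
        unfolding u_eq by (rule thin_upd_u[OF l(1)], rule thin_upd_u[OF l(2)])
      have "\<omega> \<in> A"
        using r \<omega> unfolding A_def mem_Collect_eq z G(1) rate_mismatch_def Let_def by blast
      moreover have "(U j \<omega> \<le> a \<omega>) \<noteq> (U j \<omega> \<le> b \<omega>)"
        using r unfolding a_def b_def z rate_mismatch_def Let_def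
        by (simp only: pos_le_divide_eq[OF lamstar_pos] not_False_eq_True)
      ultimately show "\<omega> \<in> ?E" using \<omega> by blast
    qed
  qed
qed

text \<open>One factor \<open>card \<Theta>\<close> counts the thresholds in a union bound, the
  other comes from the Lipschitz constant of each cumulative probability.\<close>

lemma prob_mode_mismatch:
  shows "\<exists>E\<in>events. {\<omega>\<in>space M. mode_mismatch (jt \<omega>) (\<lambda>i. U i \<omega>) (\<lambda>i. V i \<omega>) n j} \<subseteq> E \<and>
    prob E \<le> card \<Theta> * (card \<Theta> * L_Q * dev (Suc n)) * prob {\<omega>\<in>space M. j \<le> N T \<omega>}"
proof -
  have 1: "1 \<le> Suc n" by simp
  have indep: "prob (A \<inter> B \<inter> C) = prob A * prob B * prob C"
    if "A \<in> generated_events V" "B \<in> generated_events U" "C \<in> generated_events (jump_time N)" for A B C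
    using prob_Int_generated[OF that(2,1,3)] by (simp add: Int_commute mult.commute)
  obtain G where G: "space G = space M" "sets G \<subseteq> events"
    and V: "\<And>i. 1 \<le> i \<Longrightarrow> i \<noteq> Suc n \<Longrightarrow> V i \<in> borel_measurable G"
    and U: "\<And>i. 1 \<le> i \<Longrightarrow> U i \<in> borel_measurable G"
    and J: "\<And>i. 1 \<le> i \<Longrightarrow> jump_time N i \<in> borel_measurable G"
    and ind: "\<And>A B. A \<in> sets borel \<Longrightarrow> B \<in> sets G
      \<Longrightarrow> prob (V (Suc n) -` A \<inter> space M \<inter> B) = prob (V (Suc n) -` A \<inter> space M) * prob B"
    using ex_complementary_sigma_algebra[OF indep_V generated_events_subset(1,3) indep 1] by blast
  have J': "jump_time N i \<in> borel_measurable G" for i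
    using J[of i] by (cases "i = 0") (auto simp: jump_time_0[abs_def])
  let ?v = "\<lambda>i \<omega>. (V(Suc n := (\<lambda>_. 0))) i \<omega>"
  have v: "?v i \<in> borel_measurable G" if "1 \<le> i" for i
    using that V by auto
  have v_eq: "(\<lambda>i. ?v i \<omega>) = (\<lambda>i. V i \<omega>)(Suc n := 0)" for \<omega> by auto
  let ?z = "\<lambda>\<omega>. thin \<Phi> (jt \<omega>) (\<lambda>i. U i \<omega>) (\<lambda>i. ?v i \<omega>) n"
  let ?z' = "\<lambda>\<omega>. thin \<Psi> (jt \<omega>) (\<lambda>i. U i \<omega>) (\<lambda>i. ?v i \<omega>) n"
  define a where "a i \<omega> = cum_prob k Q i (fst (snd (?z \<omega>)), pre_jump \<Phi> (jt \<omega>) j (?z \<omega>))" for i \<omega>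
  define b where "b i \<omega> = cum_prob k Q i (fst (snd (?z' \<omega>)), pre_jump \<Psi> (jt \<omega>) j (?z' \<omega>))" for i \<omega>
  define A where "A = {\<omega>\<in>space G. coupled (dev n) T (jt \<omega>) j (?z \<omega>) (?z' \<omega>)}"
  have a: "a i \<in> borel_measurable G" "b i \<in> borel_measurable G" if "i \<le> card \<Theta>" for i
    unfolding a_def b_def
    by (rule measurable_at_pre_jump[where f = "cum_prob k Q i", OF J' U v mono_jump_time flow_measurable(1) cum_prob_measurable[OF _ that]]
        measurable_at_pre_jump[where f = "cum_prob k Q i", OF J' U v mono_jump_time flow_measurable(2) cum_prob_measurable[OF _ that]];
        assumption)+
  have A: "A \<in> sets G"
    unfolding A_def by (rule coupled_sets[OF J' U v mono_jump_time])
  have ab: "\<bar>a i \<omega> - b i \<omega>\<bar> \<le> card \<Theta> * L_Q * dev (Suc n)" if "i \<le> card \<Theta>" "\<omega> \<in> A" for i \<omega>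
  proof -
    have c: "coupled (dev n) T (jt \<omega>) j (?z \<omega>) (?z' \<omega>)" using that by (simp only: A_def mem_Collect_eq)
    then have eq: "fst (snd (?z' \<omega>)) = fst (snd (?z \<omega>))" unfolding coupled_def by metis
    have "\<bar>pre_jump \<Phi> (jt \<omega>) j (?z \<omega>) - pre_jump \<Psi> (jt \<omega>) j (?z' \<omega>)\<bar> \<le> dev (Suc n)"
      by (rule pre_jump_dev[OF c mono_jump_time]) (auto simp: jump_time_0 thin_mode_in)
    then have "card \<Theta> * L_Q * \<bar>pre_jump \<Phi> (jt \<omega>) j (?z \<omega>) - pre_jump \<Psi> (jt \<omega>) j (?z' \<omega>)\<bar>
        \<le> card \<Theta> * L_Q * dev (Suc n)"
      using L_nonneg by (intro mult_left_mono) auto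
    then show ?thesis
      unfolding a_def b_def eq by (rule order.trans[OF cum_prob_lipschitz[OF thin_mode_in that(1)]])
  qed
  let ?E = "\<lambda>i. {\<omega>\<in>space M. \<omega> \<in> A \<and> (V (Suc n) \<omega> \<le> a i \<omega>) \<noteq> (V (Suc n) \<omega> \<le> b i \<omega>)}"
  have \<delta>: "0 \<le> card \<Theta> * L_Q * dev (Suc n)" using L_nonneg dev_nonneg[of "Suc n"] by simp
  have E: "?E i \<in> events" "prob (?E i) \<le> card \<Theta> * L_Q * dev (Suc n) * prob A" if "i \<in> {1..card \<Theta>}" for i
  proof -
    have i: "i \<le> card \<Theta>" using that by simp
    show "?E i \<in> events" "prob (?E i) \<le> card \<Theta> * L_Q * dev (Suc n) * prob A"
      using prob_threshold_mismatch[OF data_measurable(2)[OF 1] G ind uniform_V[OF 1] a[OF i] A ab[OF i] \<delta>]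
      by blast+
  qed
  show ?thesis
  proof (intro bexI[of _ "\<Union>i\<in>{1..card \<Theta>}. ?E i"] conjI)
    show "(\<Union>i\<in>{1..card \<Theta>}. ?E i) \<in> events" using E(1) by blast
    have "A \<subseteq> {\<omega>\<in>space M. j \<le> N T \<omega>}"
      using T_pos jump_time_le_iff[OF poisson] by (auto simp: A_def coupled_def G(1))
    then have pA: "prob A \<le> prob {\<omega>\<in>space M. j \<le> N T \<omega>}"
      using N_measurable[of T] T_pos by (intro finite_measure_mono) auto
    have "prob (\<Union>i\<in>{1..card \<Theta>}. ?E i) \<le> (\<Sum>i\<in>{1..card \<Theta>}. prob (?E i))"
      using E(1) by (intro finite_measure_subadditive_finite) auto
    also have "\<dots> \<le> (\<Sum>i\<in>{1..card \<Theta>}. card \<Theta> * L_Q * dev (Suc n) * prob A)"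
      by (intro sum_mono E(2))
    also have "\<dots> = card \<Theta> * (card \<Theta> * L_Q * dev (Suc n)) * prob A"
      by simp
    also have "\<dots> \<le> card \<Theta> * (card \<Theta> * L_Q * dev (Suc n)) * prob {\<omega>\<in>space M. j \<le> N T \<omega>}"
      using pA mult_nonneg_nonneg[OF of_nat_0_le_iff \<delta>] by (intro mult_left_mono)
    finally show "prob (\<Union>i\<in>{1..card \<Theta>}. ?E i)
      \<le> card \<Theta> * (card \<Theta> * L_Q * dev (Suc n)) * prob {\<omega>\<in>space M. j \<le> N T \<omega>}" .
    show "{\<omega>\<in>space M. mode_mismatch (jt \<omega>) (\<lambda>i. U i \<omega>) (\<lambda>i. V i \<omega>) n j} \<subseteq> (\<Union>i\<in>{1..card \<Theta>}. ?E i)"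
    proof
      fix \<omega> assume "\<omega> \<in> {\<omega>\<in>space M. mode_mismatch (jt \<omega>) (\<lambda>i. U i \<omega>) (\<lambda>i. V i \<omega>) n j}"
      then have \<omega>: "\<omega> \<in> space M" and r: "mode_mismatch (jt \<omega>) (\<lambda>i. U i \<omega>) (\<lambda>i. V i \<omega>) n j" by auto
      have z: "?z \<omega> = thin \<Phi> (jt \<omega>) (\<lambda>i. U i \<omega>) (\<lambda>i. V i \<omega>) n"
        "?z' \<omega> = thin \<Psi> (jt \<omega>) (\<lambda>i. U i \<omega>) (\<lambda>i. V i \<omega>) n"
        unfolding v_eq by (intro thin_upd_v lessI)+
      have "\<omega> \<in> A"
        using r \<omega> unfolding A_def mem_Collect_eq z G(1) mode_mismatch_def Let_def by blast
      moreover have "\<exists>i\<in>{1..card \<Theta>}. (V (Suc n) \<omega> \<le> a i \<omega>) \<noteq> (V (Suc n) \<omega> \<le> b i \<omega>)"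
        using r unfolding a_def b_def z mode_mismatch_def Let_def by (intro select_mode_neqD) blast
      ultimately show "\<omega> \<in> (\<Union>i\<in>{1..card \<Theta>}. ?E i)" using \<omega> by blast
    qed
  qed
qed

end

section \<open>Total mismatch probability and mean square error\<close>

context coupled_pdps
begin

definition mismatch_const :: real where
  "mismatch_const = L_lam / lamstar + card \<Theta> * (card \<Theta> * L_Q)"

lemma mismatch_const_nonneg: "0 \<le> mismatch_const"
  using L_nonneg lamstar_pos by (simp add: mismatch_const_def)

abbreviation (input) mismatch where
  "mismatch \<omega> n j \<equiv> rate_mismatch (jt \<omega>) (\<lambda>i. U i \<omega>) (\<lambda>i. V i \<omega>) n j \<or>
     mode_mismatch (jt \<omega>) (\<lambda>i. U i \<omega>) (\<lambda>i. V i \<omega>) n j"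

lemma mismatch_less: "mismatch \<omega> n j \<Longrightarrow> n < j"
  by (auto simp: rate_mismatch_def mode_mismatch_def Let_def dest: coupled_thin_less)

text \<open>For \<open>n < j\<close> the bound \<open>dev (Suc n)\<close> is at most
  \<open>dev j\<close>, and there are \<open>j\<close> such \<open>n\<close>.\<close>

lemma prob_mismatch_at:
  assumes "1 \<le> j"
  shows "\<exists>E\<in>events. {\<omega>\<in>space M. \<exists>n<j. mismatch \<omega> n j} \<subseteq> E \<and>
    prob E \<le> j * (mismatch_const * dev j * prob {\<omega>\<in>space M. j \<le> N T \<omega>})"
proof -
  let ?p = "prob {\<omega>\<in>space M. j \<le> N T \<omega>}"
  have "\<exists>E. E \<in> events \<and> {\<omega>\<in>space M. n < j \<and> mismatch \<omega> n j} \<subseteq> E \<and> prob E \<le> mismatch_const * dev j * ?p" for n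
  proof (cases "n < j")
    case True
    obtain E1 where E1: "E1 \<in> events"
        "{\<omega>\<in>space M. rate_mismatch (jt \<omega>) (\<lambda>i. U i \<omega>) (\<lambda>i. V i \<omega>) n j} \<subseteq> E1"
        "prob E1 \<le> L_lam * dev (Suc n) / lamstar * ?p"
      using prob_rate_mismatch[OF assms, of n] by blast
    obtain E2 where E2: "E2 \<in> events"
        "{\<omega>\<in>space M. mode_mismatch (jt \<omega>) (\<lambda>i. U i \<omega>) (\<lambda>i. V i \<omega>) n j} \<subseteq> E2"
        "prob E2 \<le> card \<Theta> * (card \<Theta> * L_Q * dev (Suc n)) * ?p"
      using prob_mode_mismatch[of n j] by blast
    have "prob (E1 \<union> E2) \<le> prob E1 + prob E2"
      by (rule measure_Un_le[OF E1(1) E2(1)])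
    also have "\<dots> \<le> mismatch_const * dev (Suc n) * ?p"
      using E1(3) E2(3) by (simp add: mismatch_const_def algebra_simps)
    also have "\<dots> \<le> mismatch_const * dev j * ?p"
      using True by (intro mult_right_mono mult_left_mono dev_mono mismatch_const_nonneg) auto
    finally show ?thesis
      using E1(1,2) E2(1,2) by (intro exI[of _ "E1 \<union> E2"]) blast
  next
    case False
    then show ?thesis
      using mismatch_const_nonneg dev_nonneg[of j] by (intro exI[of _ "{}"]) auto
  qed
  then have "\<forall>n. \<exists>E. E \<in> events \<and> {\<omega>\<in>space M. n < j \<and> mismatch \<omega> n j} \<subseteq> E \<and> prob E \<le> mismatch_const * dev j * ?p"
    by blast
  from choice[OF this] obtain E where E: "\<And>n. E n \<in> events"
      "\<And>n. {\<omega>\<in>space M. n < j \<and> mismatch \<omega> n j} \<subseteq> E n" "\<And>n. prob (E n) \<le> mismatch_const * dev j * ?p"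
    by blast
  show ?thesis
  proof (intro bexI[of _ "\<Union>n<j. E n"] conjI)
    show "(\<Union>n<j. E n) \<in> events" using E(1) by auto
    show "{\<omega>\<in>space M. \<exists>n<j. mismatch \<omega> n j} \<subseteq> (\<Union>n<j. E n)"
      using E(2) by blast
    have "prob (\<Union>n<j. E n) \<le> (\<Sum>n<j. prob (E n))"
      using E(1) by (intro finite_measure_subadditive_finite) auto
    also have "\<dots> \<le> (\<Sum>n<j. mismatch_const * dev j * ?p)"
      by (intro sum_mono E(3))
    finally show "prob (\<Union>n<j. E n) \<le> j * (mismatch_const * dev j * ?p)"
      by simp
  qed
qed

text \<open>The base \<open>4 * (K + 1)\<close> in the Markov bound cancels the growth of
  \<open>dev j\<close> and leaves \<open>(1 / 4) ^ j\<close>. Of this, \<open>2 ^ j\<close> pays for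
  the factor \<open>j\<close>, and the remaining geometric series sums to 2.\<close>

lemma prob_mismatch:
  "\<exists>E\<in>events. {\<omega>\<in>space M. \<exists>n j. mismatch \<omega> n j} \<subseteq> E \<and>
    prob E \<le> 2 * mismatch_const * \<epsilon> * expectation (\<lambda>\<omega>. (4 * (K + 1)) ^ N T \<omega>)"
proof -
  let ?W = "expectation (\<lambda>\<omega>. (4 * (K + 1)) ^ N T \<omega>)"
  have R: "1 \<le> K + 1" using K_nonneg by simp
  have W: "0 \<le> ?W" using R by (intro integral_nonneg_AE) auto
  have cancel: "real j * (c * (e * r ^ j) * (w / (4 * r) ^ j)) = c * e * w * (j * (1 / 4) ^ j)"
    if "1 \<le> r" for c e w r :: real and j
    using that by (simp add: power_mult_distrib power_divide field_simps)
  have "\<exists>E\<in>events. {\<omega>\<in>space M. \<exists>n. mismatch \<omega> n j} \<subseteq> E \<and>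
      prob E \<le> mismatch_const * \<epsilon> * ?W * (1 / 2) ^ j" for j
  proof (cases "j = 0")
    case True
    then show ?thesis
      using mismatch_less[of _ _ j] mismatch_const_nonneg \<epsilon>_nonneg W by (intro bexI[of _ "{}"]) auto
  next
    case False
    then obtain E where E: "E \<in> events" "{\<omega>\<in>space M. \<exists>n<j. mismatch \<omega> n j} \<subseteq> E"
        "prob E \<le> j * (mismatch_const * dev j * prob {\<omega>\<in>space M. j \<le> N T \<omega>})"
      using prob_mismatch_at[of j] by auto
    note E(3)
    also have "j * (mismatch_const * dev j * prob {\<omega>\<in>space M. j \<le> N T \<omega>})
        \<le> j * (mismatch_const * dev j * (?W / (4 * (K + 1)) ^ j))"
      using T_pos lamstar_pos R mismatch_const_nonneg dev_nonneg[of j]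
      by (intro mult_left_mono prob_N_ge mult_nonneg_nonneg) auto
    also have "\<dots> = mismatch_const * \<epsilon> * ?W * (j * (1 / 4) ^ j)"
      unfolding dev_def by (rule cancel[OF R])
    also have "real j * (1 / 4) ^ j \<le> 2 ^ j * (1 / 4) ^ j"
      using of_nat_less_two_power[of j, where 'a = real] by (intro mult_right_mono) auto
    also have "2 ^ j * (1 / 4) ^ j = (1 / 2 :: real) ^ j"
      by (simp add: power_mult_distrib[symmetric])
    finally have "prob E \<le> mismatch_const * \<epsilon> * ?W * (1 / 2) ^ j"
      using mismatch_const_nonneg \<epsilon>_nonneg W by (simp add: mult_left_mono)
    moreover have "{\<omega>\<in>space M. \<exists>n. mismatch \<omega> n j} \<subseteq> E"
      using E(2) mismatch_less by blast
    ultimately show ?thesis using E(1) by blast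
  qed
  then have "\<forall>j. \<exists>E. E \<in> events \<and> {\<omega>\<in>space M. \<exists>n. mismatch \<omega> n j} \<subseteq> E \<and>
      prob E \<le> mismatch_const * \<epsilon> * ?W * (1 / 2) ^ j"
    by blast
  from choice[OF this] obtain E where E: "\<And>j. E j \<in> events" "\<And>j. {\<omega>\<in>space M. \<exists>n. mismatch \<omega> n j} \<subseteq> E j"
      "\<And>j. prob (E j) \<le> mismatch_const * \<epsilon> * ?W * (1 / 2) ^ j"
    by blast
  have geo: "(\<lambda>j. mismatch_const * \<epsilon> * ?W * (1 / 2) ^ j) sums (mismatch_const * \<epsilon> * ?W * 2)"
    using geometric_sums[of "1 / 2 :: real"] by (intro sums_mult) simp
  have sm: "summable (\<lambda>j. prob (E j))"
    by (rule summable_comparison_test'[OF sums_summable[OF geo], of 0]) (use E(3) in auto)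
  show ?thesis
  proof (intro bexI[of _ "\<Union>j. E j"] conjI)
    show "(\<Union>j. E j) \<in> events" using E(1) by auto
    show "{\<omega>\<in>space M. \<exists>n j. mismatch \<omega> n j} \<subseteq> (\<Union>j. E j)" using E(2) by blast
    have "prob (\<Union>j. E j) \<le> (\<Sum>j. prob (E j))"
      using E(1) sm by (intro finite_measure_subadditive_countably) auto
    also have "\<dots> \<le> (\<Sum>j. mismatch_const * \<epsilon> * ?W * (1 / 2) ^ j)"
      by (intro suminf_le E(3) sm sums_summable[OF geo])
    also have "\<dots> = 2 * mismatch_const * \<epsilon> * ?W" using sums_unique[OF geo] by simp
    finally show "prob (\<Union>j. E j) \<le> 2 * mismatch_const * \<epsilon> * ?W" .
  qed
qed

lemma measurable_pdp:
  assumes \<Phi>': "flow_measurable \<Theta> \<Phi>'"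
    and F: "\<And>\<theta>. \<theta> \<in> \<Theta> \<Longrightarrow> (\<lambda>\<nu>. F (\<theta>, \<nu>)) \<in> borel_measurable borel"
  shows "(\<lambda>\<omega>. F (pdp \<Theta> k lamstar \<Phi>' lam Q x0 N U V T \<omega>)) \<in> borel_measurable M"
proof -
  have J: "jump_time N i \<in> borel_measurable M" for i
    using data_measurable(3)[of i] by (cases "i = 0") (auto simp: jump_time_0[abs_def])
  show ?thesis
    unfolding pdp_def
  proof (rule measurable_pdp_path[OF \<Phi>' J data_measurable(1,2) mono_jump_time F])
    show "jump_time N 0 \<omega> \<le> ereal T" for \<omega> using T_pos by (simp add: jump_time_0)
    show "\<exists>m. ereal T < jump_time N m \<omega>" if "\<omega> \<in> space M" for \<omega>
      using jump_time_le_iff[OF poisson that, of T "Suc (N T \<omega>)"] T_pos by (auto simp: not_le[symmetric])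
  qed
qed

text \<open>The constant 8 is the bound \<open>4 * B\<^sup>2\<close> on the mismatch event times the
  2 in \<open>prob_mismatch\<close>. Integrability is claimed separately because the integral of a
  non-integrable function is 0 by convention.\<close>

lemma expected_squared_error:
  fixes F :: "'k \<times> real \<Rightarrow> real"
  defines "err \<equiv> \<lambda>\<omega>. \<bar>F (pdp \<Theta> k lamstar \<Psi> lam Q x0 N U V T \<omega>) - F (pdp \<Theta> k lamstar \<Phi> lam Q x0 N U V T \<omega>)\<bar>\<^sup>2"
  assumes bound: "\<And>y. y \<in> \<Theta> \<times> UNIV \<Longrightarrow> \<bar>F y\<bar> \<le> B"
    and lipschitz: "\<And>\<theta>. \<theta> \<in> \<Theta> \<Longrightarrow> L-lipschitz_on UNIV (\<lambda>\<nu>. F (\<theta>, \<nu>))"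
  shows "integrable M err"
    and "expectation err \<le> 8 * B\<^sup>2 * mismatch_const * expectation (\<lambda>\<omega>. (4 * (K + 1)) ^ N T \<omega>) * \<epsilon>
      + L\<^sup>2 * (K + 1)\<^sup>2 * expectation (\<lambda>\<omega>. ((K + 1)\<^sup>2) ^ N T \<omega>) * \<epsilon>\<^sup>2"
proof -
  let ?x = "pdp \<Theta> k lamstar \<Phi> lam Q x0 N U V T" and ?y = "pdp \<Theta> k lamstar \<Psi> lam Q x0 N U V T"
  have F: "(\<lambda>\<nu>. F (\<theta>, \<nu>)) \<in> borel_measurable borel" if "\<theta> \<in> \<Theta>" for \<theta>
    by (rule borel_measurable_continuous_onI[OF lipschitz_on_continuous_on[OF lipschitz[OF that]]])
  have [measurable]: "(\<lambda>\<omega>. F (?x \<omega>)) \<in> borel_measurable M" "(\<lambda>\<omega>. F (?y \<omega>)) \<in> borel_measurable M"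
    by (rule measurable_pdp[OF flow_measurable(1) F] measurable_pdp[OF flow_measurable(2) F]; assumption)+
  have meas: "err \<in> borel_measurable M" unfolding err_def by measurable
  have in_E: "?x \<omega> \<in> \<Theta> \<times> UNIV" "?y \<omega> \<in> \<Theta> \<times> UNIV" for \<omega>
    unfolding pdp_def by (rule pdp_path_in)+
  have le_B: "err \<omega> \<le> 4 * B\<^sup>2" for \<omega>
  proof -
    have "\<bar>F (?y \<omega>) - F (?x \<omega>)\<bar> \<le> 2 * B"
      using bound[OF in_E(1)[of \<omega>]] bound[OF in_E(2)[of \<omega>]] by linarith
    from power_mono[OF this, of 2] show ?thesis by (simp add: err_def power_mult_distrib)
  qed
  show int: "integrable M err"
    by (rule integrable_const_bound[where B = "4 * B\<^sup>2"]) (use le_B meas in \<open>auto simp: err_def\<close>)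
  obtain E where E: "E \<in> events" "{\<omega>\<in>space M. \<exists>n j. mismatch \<omega> n j} \<subseteq> E"
      "prob E \<le> 2 * mismatch_const * \<epsilon> * expectation (\<lambda>\<omega>. (4 * (K + 1)) ^ N T \<omega>)"
    using prob_mismatch by blast
  have intN: "integrable M (\<lambda>\<omega>. ((K + 1)\<^sup>2) ^ N T \<omega>)"
    by (rule integrable_power_N[OF T_pos lamstar_pos])
  have good: "err \<omega> \<le> L\<^sup>2 * (K + 1)\<^sup>2 * \<epsilon>\<^sup>2 * ((K + 1)\<^sup>2) ^ N T \<omega>" if "\<omega> \<in> space M" "\<omega> \<notin> E" for \<omega>
  proof -
    have "\<not> mismatch \<omega> n j" for n j using E(2) that by blast
    then have "fst (?x \<omega>) = fst (?y \<omega>)" and d: "\<bar>snd (?x \<omega>) - snd (?y \<omega>)\<bar> \<le> dev (Suc (N T \<omega>))"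
      unfolding pdp_def
      using pdp_path_close[OF mono_jump_time jump_time_0, of N \<omega> "N T \<omega>" "\<lambda>i. U i \<omega>" "\<lambda>i. V i \<omega>"]
        jump_time_le_iff[OF poisson that(1)] T_pos by auto
    then obtain \<theta> a b where xy: "?x \<omega> = (\<theta>, a)" "?y \<omega> = (\<theta>, b)" "\<theta> \<in> \<Theta>" "\<bar>a - b\<bar> \<le> dev (Suc (N T \<omega>))"
      using in_E(1)[of \<omega>] by (cases "?x \<omega>"; cases "?y \<omega>") auto
    have "\<bar>F (?y \<omega>) - F (?x \<omega>)\<bar> \<le> L * \<bar>a - b\<bar>"
      using lipschitz_onD[OF lipschitz[OF xy(3)], of b a] by (simp add: xy dist_real_def abs_minus_commute)
    also have "\<dots> \<le> L * dev (Suc (N T \<omega>))"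
      using xy(4) lipschitz_on_nonneg[OF lipschitz[OF xy(3)]] by (intro mult_left_mono)
    finally have "err \<omega> \<le> (L * dev (Suc (N T \<omega>)))\<^sup>2"
      unfolding err_def by (intro power_mono) auto
    \<comment> \<open>Squaring the power with exponent \<open>Suc (N T \<omega>)\<close> splits off
      \<open>(K + 1)\<^sup>2\<close> and leaves a power of \<open>(K + 1)\<^sup>2\<close> with
      exponent \<open>N T \<omega>\<close>, which is integrable.\<close>
    also have "\<dots> = L\<^sup>2 * (K + 1)\<^sup>2 * \<epsilon>\<^sup>2 * ((K + 1)\<^sup>2) ^ N T \<omega>"
      by (simp add: dev_def power_mult_distrib flip: power_mult) (simp add: mult.commute)
    finally show ?thesis .
  qed
  have "expectation err \<le> expectation (\<lambda>\<omega>. 4 * B\<^sup>2 * indicator E \<omega> + L\<^sup>2 * (K + 1)\<^sup>2 * \<epsilon>\<^sup>2 * ((K + 1)\<^sup>2) ^ N T \<omega>)"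
  proof (intro integral_mono int Bochner_Integration.integrable_add integrable_mult_right intN)
    show "integrable M (indicator E :: _ \<Rightarrow> real)" using E(1) by (simp add: integrable_indicator_iff emeasure_eq_measure)
    fix \<omega> assume "\<omega> \<in> space M"
    then show "err \<omega> \<le> 4 * B\<^sup>2 * indicator E \<omega> + L\<^sup>2 * (K + 1)\<^sup>2 * \<epsilon>\<^sup>2 * ((K + 1)\<^sup>2) ^ N T \<omega>"
      using le_B[of \<omega>] good[of \<omega>] by (cases "\<omega> \<in> E") (auto intro: add_increasing2)
  qed
  also have "\<dots> = 4 * B\<^sup>2 * prob E + L\<^sup>2 * (K + 1)\<^sup>2 * \<epsilon>\<^sup>2 * expectation (\<lambda>\<omega>. ((K + 1)\<^sup>2) ^ N T \<omega>)"
    using E(1) intN by (subst Bochner_Integration.integral_add)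
      (auto simp: integrable_indicator_iff emeasure_eq_measure)
  also have "4 * B\<^sup>2 * prob E \<le> 4 * B\<^sup>2 * (2 * mismatch_const * \<epsilon> * expectation (\<lambda>\<omega>. (4 * (K + 1)) ^ N T \<omega>))"
    using E(3) by (intro mult_left_mono) auto
  finally show "expectation err \<le> 8 * B\<^sup>2 * mismatch_const * expectation (\<lambda>\<omega>. (4 * (K + 1)) ^ N T \<omega>) * \<epsilon>
      + L\<^sup>2 * (K + 1)\<^sup>2 * expectation (\<lambda>\<omega>. ((K + 1)\<^sup>2) ^ N T \<omega>) * \<epsilon>\<^sup>2"
    by (simp add: mult_ac)
qed

end

theorem theorem3p1:
  fixes M :: "'w measure"
    and \<Theta> :: "'k set" and k :: "nat \<Rightarrow> 'k"
    and lamstar T C1 C2 L_lam L_Q :: real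
    and N :: "real \<Rightarrow> 'w \<Rightarrow> nat"
    and U V :: "nat \<Rightarrow> 'w \<Rightarrow> real"
    and \<Phi> :: "'k \<Rightarrow> real \<Rightarrow> real \<Rightarrow> real"
    and \<Phi>bar :: "real \<Rightarrow> 'k \<Rightarrow> real \<Rightarrow> real \<Rightarrow> real"
    and lam :: "'k \<times> real \<Rightarrow> real"
    and Q :: "'k \<times> real \<Rightarrow> ('k \<times> real) measure"
    and x :: "'k \<times> real"
  assumes "finite \<Theta>" and "bij_betw k {1..card \<Theta>} \<Theta>"
    and "thinning_data M lamstar N U V"
    and "pdp_characteristics \<Theta> \<Phi> lam Q"
    and "\<And>h. h > 0 \<Longrightarrow> pdp_characteristics \<Theta> (\<Phi>bar h) lam Q"
    and "\<And>y. y \<in> \<Theta> \<times> UNIV \<Longrightarrow> lam y \<le> lamstar"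
    and "T > 0" and "x \<in> \<Theta> \<times> UNIV"
    and "C1 > 0" and "C2 > 0"
    and "\<And>h. h > 0 \<Longrightarrow> flow_estimate \<Theta> T C1 C2 h \<Phi> (\<Phi>bar h)"
    and "L_lam > 0" and "\<And>\<theta>. \<theta> \<in> \<Theta> \<Longrightarrow> L_lam-lipschitz_on UNIV (\<lambda>\<nu>. lam (\<theta>, \<nu>))"
    and "L_Q > 0"
    and "\<And>\<theta> A. \<theta> \<in> \<Theta> \<Longrightarrow> A \<subseteq> \<Theta> \<Longrightarrow> L_Q-lipschitz_on UNIV (\<lambda>\<nu>. mode_prob Q (\<theta>, \<nu>) A)"
  shows "\<forall>F :: 'k \<times> real \<Rightarrow> real. \<forall>L_F>0.
           bounded (F ` (\<Theta> \<times> UNIV)) \<longrightarrow>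
           (\<forall>\<theta>\<in>\<Theta>. L_F-lipschitz_on UNIV (\<lambda>\<nu>. F (\<theta>, \<nu>))) \<longrightarrow>
           (\<exists>V1>0. \<exists>V2>0. \<forall>h>0.
              (let err = (\<lambda>\<omega>. \<bar>F (pdp \<Theta> k lamstar (\<Phi>bar h) lam Q x N U V T \<omega>)
                               - F (pdp \<Theta> k lamstar \<Phi> lam Q x N U V T \<omega>)\<bar>\<^sup>2)
               in integrable M err \<and> integral\<^sup>L M err \<le> V1 * h + V2 * h\<^sup>2))"
proof (intro allI impI)
  fix F :: "'k \<times> real \<Rightarrow> real" and L :: real
  assume "L > 0" and bdd: "bounded (F ` (\<Theta> \<times> UNIV))"
    and lip: "\<forall>\<theta>\<in>\<Theta>. L-lipschitz_on UNIV (\<lambda>\<nu>. F (\<theta>, \<nu>))"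
  obtain B where B: "\<And>y. y \<in> \<Theta> \<times> UNIV \<Longrightarrow> \<bar>F y\<bar> \<le> B"
    using bdd unfolding bounded_iff by auto
  interpret D: thinning_data M lamstar N U V by fact
  have lamstar: "0 < lamstar"
    using assms(4,6)[unfolded pdp_characteristics_def] \<open>x \<in> \<Theta> \<times> UNIV\<close> by (meson less_le_trans)
  have dist: "\<bar>f a - f b\<bar> \<le> C * \<bar>a - b\<bar>" if "C-lipschitz_on UNIV f" for C :: real and f :: "real \<Rightarrow> real" and a b
    using lipschitz_onD[OF that, of a b] by (simp add: dist_real_def)
  have meas: "f \<in> borel_measurable borel" if "C-lipschitz_on UNIV f" for C :: real and f :: "real \<Rightarrow> real"
    by (rule borel_measurable_continuous_onI[OF lipschitz_on_continuous_on[OF that]])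
  define K where "K = exp (C1 * T)"
  \<comment> \<open>The value of \<open>mismatch_const\<close>, written out because that constant
    lives in a locale whose parameters involve \<open>h\<close>, whereas \<open>V1\<close> must be
    fixed before \<open>h\<close>.\<close>
  define c where "c = L_lam / lamstar + card \<Theta> * (card \<Theta> * L_Q)"
  define W where "W = D.expectation (\<lambda>\<omega>. (4 * (K + 1)) ^ N T \<omega>)"
  define W' where "W' = D.expectation (\<lambda>\<omega>. ((K + 1)\<^sup>2) ^ N T \<omega>)"
  have nonneg: "0 \<le> K" "0 \<le> c" "0 \<le> W" "0 \<le> W'"
    using lamstar \<open>L_lam > 0\<close> \<open>L_Q > 0\<close>
    by (auto simp: K_def c_def W_def W'_def intro!: integral_nonneg_AE add_nonneg_nonneg)
  \<comment> \<open>The added 1 keeps the constant positive even when the main term vanishes, as for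
    \<open>B = 0\<close>; likewise in \<open>V2\<close>.\<close>
  define V1 where "V1 = 8 * B\<^sup>2 * c * W * C2 + 1"
  define V2 where "V2 = L\<^sup>2 * (K + 1)\<^sup>2 * W' * C2\<^sup>2 + 1"
  have "0 < V1" "0 < V2"
    using nonneg \<open>C2 > 0\<close> by (auto simp: V1_def V2_def intro!: add_nonneg_pos)
  moreover have "let err = (\<lambda>\<omega>. \<bar>F (pdp \<Theta> k lamstar (\<Phi>bar h) lam Q x N U V T \<omega>)
                   - F (pdp \<Theta> k lamstar \<Phi> lam Q x N U V T \<omega>)\<bar>\<^sup>2)
               in integrable M err \<and> integral\<^sup>L M err \<le> V1 * h + V2 * h\<^sup>2" if "0 < h" for h
  proof -
    interpret P: coupled_pdps \<Theta> k lamstar lam Q x \<Phi> "\<Phi>bar h" T K "C2 * h" L_lam L_Q M N U V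
    proof (intro coupled_pdps.intro thinning_pair.intro thinning_pair_axioms.intro thinning_modes.intro)
      show "thinning_data M lamstar N U V" by fact
      show "flow_measurable \<Theta> \<Phi>" "flow_measurable \<Theta> (\<Phi>bar h)"
        using assms(4) assms(5)[OF that] by (auto simp: pdp_characteristics_def)
      show "\<bar>\<Phi> \<theta> t a - \<Phi>bar h \<theta> t b\<bar> \<le> K * \<bar>a - b\<bar> + C2 * h" if "\<theta> \<in> \<Theta>" "0 \<le> t" "t \<le> T" for \<theta> t a b
        unfolding K_def by (rule flow_estimateD[OF assms(11)[OF \<open>0 < h\<close>] that(1) \<open>T > 0\<close> that(2,3)])
      show "(\<lambda>\<nu>. lam (\<theta>, \<nu>)) \<in> borel_measurable borel" if "\<theta> \<in> \<Theta>" for \<theta>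
        by (rule meas[OF assms(13)[OF that]])
      show "(\<lambda>\<nu>. mode_prob Q (\<theta>, \<nu>) A) \<in> borel_measurable borel" if "\<theta> \<in> \<Theta>" "A \<subseteq> \<Theta>" for \<theta> A
        by (rule meas[OF assms(15)[OF that]])
    qed (use assms lamstar nonneg that in \<open>auto intro: dist\<close>)
    have c: "P.mismatch_const = c" by (simp add: P.mismatch_const_def c_def)
    note err = P.expected_squared_error[of F B L, OF B lip[rule_format]]
    \<comment> \<open>The surplus \<open>h + h\<^sup>2\<close> is the contribution of the two added
      ones.\<close>
    have "8 * B\<^sup>2 * c * W * (C2 * h) + L\<^sup>2 * (K + 1)\<^sup>2 * W' * (C2 * h)\<^sup>2 + (h + h\<^sup>2) = V1 * h + V2 * h\<^sup>2"
      unfolding V1_def V2_def by (simp only: power_mult_distrib algebra_simps mult_1 mult_1_right)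
    moreover have "0 \<le> h + h\<^sup>2" using that by simp
    ultimately have "8 * B\<^sup>2 * c * W * (C2 * h) + L\<^sup>2 * (K + 1)\<^sup>2 * W' * (C2 * h)\<^sup>2 \<le> V1 * h + V2 * h\<^sup>2"
      by linarith
    from order.trans[OF err(2)[unfolded c W_def[symmetric] W'_def[symmetric]] this] err(1)
    show ?thesis unfolding Let_def by blast
  qed
  ultimately show "\<exists>V1>0. \<exists>V2>0. \<forall>h>0.
      (let err = (\<lambda>\<omega>. \<bar>F (pdp \<Theta> k lamstar (\<Phi>bar h) lam Q x N U V T \<omega>)
                       - F (pdp \<Theta> k lamstar \<Phi> lam Q x N U V T \<omega>)\<bar>\<^sup>2)
       in integrable M err \<and> integral\<^sup>L M err \<le> V1 * h + V2 * h\<^sup>2)"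
    by blast
qed

end
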